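(* Every homogeneous diffeological space is fibrant; that is, if $G$ is a diffeological group and $H$ is a subgroup of $G$, then the set $G/H$ of left (or right) cosets with the quotient diffeology is a fibrant diffeological space.
   Context: A diffeological space is a set $X$ together with, for each $n\in\mathbb{N}$ and each open $U\subseteq\mathbb{R}^n$, a specified set of functions $U\to X$ called plots, such that: every constant map is a plot; if $U\to X$ is a plot and $V\to U$ is a smooth map between open subsets of Euclidean spaces then the composite $V\to X$ is a plot; and a function $U\to X$ whose restriction to each member of some open cover of $U$ is a plot is itself a plot. A map $f:X\to Y$ is smooth if $f\circ p$ is a plot of $Y$ for every plot $p$ of $X$; $C^\infty(X,Y)$ is the set of smooth maps. Products have plots with both components plots. $\mathbb{R}^n$ has as plots the usual smooth maps. A subset $A\subseteq X$ has the sub-diffeology: $U\to A$ is a plot iff $U\to A\hookrightarrow X$ is. For an equivalence relation $\sim$ on $X$, the quotient diffeology on $X/{\sim}$ consists of all maps $U\to X/{\sim}$ that locally lift to plots of $X$ through the quotient map. A diffeological group is a group object in the category of diffeological spaces, i.e. a diffeological space with a group structure whose multiplication and inversion are smooth. Let $\mathbb{A}^n=\{(x_0,\dots,x_n)\in\mathbb{R}^{n+1}\mid\sum x_i=1\}$ with the sub-diffeology from $\mathbb{R}^{n+1}$. A map $f:\{0,\dots,n\}\to\{0,\dots,m\}$ in the simplicial category induces $f_*:\mathbb{A}^n\to\mathbb{A}^m$, $f_*(x)_j=\sum_{i\in f^{-1}(j)}x_i$. $S^D(X)$ is the simplicial set with $S^D_n(X)=C^\infty(\mathbb{A}^n,X)$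 and structure maps given by precomposition. A diffeological space $X$ is fibrant if $S^D(X)$ is a Kan complex. *)

theory Defs
  imports "HOL-Analysis.Analysis" "HOL-Algebra.Coset"
begin

section \<open>Smooth maps between open subsets of Euclidean spaces\<close>

text \<open>
  The dimension of the domain of a plot varies, so \<open>\<real>\<^sup>n\<close> is the library's
  \<^const>\<open>Euclidean_space\<close> \<open>n\<close>: its points are the functions \<open>nat \<Rightarrow> real\<close> vanishing at all
  \<open>i \<ge> n\<close>, and \<open>x i\<close> is the \<open>i\<close>-th coordinate (\<open>i < n\<close>).

  In \<open>Ck_on\<close> the function \<open>g\<close> is the \<open>i\<close>-th partial derivative of \<open>f\<close>. As \<open>U\<close> is open in
  \<open>\<real>\<^sup>n\<close>, only the values of \<open>f\<close> on \<open>U\<close> matter.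
\<close>

fun Ck_on :: "nat \<Rightarrow> nat \<Rightarrow> (nat \<Rightarrow> real) set \<Rightarrow> ((nat \<Rightarrow> real) \<Rightarrow> real) \<Rightarrow> bool" where
  "Ck_on 0 n U f \<longleftrightarrow> continuous_map (subtopology (Euclidean_space n) U) euclideanreal f"
| "Ck_on (Suc k) n U f \<longleftrightarrow>
     continuous_map (subtopology (Euclidean_space n) U) euclideanreal f \<and>
     (\<forall>i<n. \<exists>g. Ck_on k n U g \<and>
        (\<forall>x\<in>U. ((\<lambda>t. f (x(i := t))) has_real_derivative g x) (at (x i))))"

definition smooth_between ::
  "nat \<Rightarrow> (nat \<Rightarrow> real) set \<Rightarrow> nat \<Rightarrow> (nat \<Rightarrow> real) set \<Rightarrow> ((nat \<Rightarrow> real) \<Rightarrow> (nat \<Rightarrow> real)) \<Rightarrow> bool"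
  where "smooth_between n U m V f \<longleftrightarrow>
    openin (Euclidean_space n) U \<and> openin (Euclidean_space m) V \<and> f \<in> U \<rightarrow> V \<and>
    (\<forall>j<m. \<forall>k. Ck_on k n U (\<lambda>x. f x j))"


section \<open>Diffeological spaces\<close>

text \<open>
  \<open>plots X n U\<close> is the set of plots with domain the open set \<open>U \<subseteq> \<real>\<^sup>n\<close>. A function between sets is
  represented by a total function that is \<^const>\<open>undefined\<close> off its domain
  (\<^const>\<open>extensional\<close>), so that equality of functions is HOL equality.
\<close>

record 'a diffeology =
  points :: "'a set"
  plots :: "nat \<Rightarrow> (nat \<Rightarrow> real) set \<Rightarrow> ((nat \<Rightarrow> real) \<Rightarrow> 'a) set"

locale diffeological_space =
  fixes X :: "'a diffeology"
  assumes plot_domain: "p \<in> plots X n U \<Longrightarrow> openin (Euclidean_space n) U"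
    and plot_function: "p \<in> plots X n U \<Longrightarrow> p \<in> U \<rightarrow>\<^sub>E points X"
    and plot_const: "openin (Euclidean_space n) U \<Longrightarrow> x \<in> points X \<Longrightarrow> (\<lambda>u\<in>U. x) \<in> plots X n U"
    and plot_compose: "p \<in> plots X n U \<Longrightarrow> smooth_between m V n U h \<Longrightarrow> compose V p h \<in> plots X m V"
    and plot_local: "openin (Euclidean_space n) U \<Longrightarrow> p \<in> U \<rightarrow>\<^sub>E points X \<Longrightarrow>
      (\<And>V. V \<in> \<V> \<Longrightarrow> openin (Euclidean_space n) V) \<Longrightarrow> \<Union>\<V> = U \<Longrightarrow>
      (\<And>V. V \<in> \<V> \<Longrightarrow> restrict p V \<in> plots X n V) \<Longrightarrow> p \<in> plots X n U"

definition smooth_maps :: "'a diffeology \<Rightarrow> 'b diffeology \<Rightarrow> ('a \<Rightarrow> 'b) set" where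
  "smooth_maps X Y =
    {f \<in> points X \<rightarrow>\<^sub>E points Y. \<forall>n U. \<forall>p \<in> plots X n U. compose U f p \<in> plots Y n U}"

definition product_diffeology :: "'a diffeology \<Rightarrow> 'b diffeology \<Rightarrow> ('a \<times> 'b) diffeology" where
  "product_diffeology X Y =
    \<lparr>points = points X \<times> points Y,
     plots = \<lambda>n U. {p \<in> U \<rightarrow>\<^sub>E points X \<times> points Y.
       compose U fst p \<in> plots X n U \<and> compose U snd p \<in> plots Y n U}\<rparr>"

definition euclidean_diffeology :: "nat \<Rightarrow> (nat \<Rightarrow> real) diffeology" where
  "euclidean_diffeology m =
    \<lparr>points = topspace (Euclidean_space m),
     plots = \<lambda>n U. {p \<in> extensional U. smooth_between n U m (topspace (Euclidean_space m)) p}\<rparr>"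

text \<open>Only meant for \<open>A \<subseteq> points X\<close>.\<close>

definition sub_diffeology :: "'a diffeology \<Rightarrow> 'a set \<Rightarrow> 'a diffeology" where
  "sub_diffeology X A = \<lparr>points = A, plots = \<lambda>n U. {p \<in> U \<rightarrow>\<^sub>E A. p \<in> plots X n U}\<rparr>"

text \<open>Only meant for equivalence relations \<open>R\<close> on \<open>points X\<close>; \<open>R `` {x}\<close> is the class of \<open>x\<close>.\<close>

definition quotient_diffeology :: "'a diffeology \<Rightarrow> ('a \<times> 'a) set \<Rightarrow> 'a set diffeology" where
  "quotient_diffeology X R =
    \<lparr>points = points X // R,
     plots = \<lambda>n U. {p \<in> U \<rightarrow>\<^sub>E points X // R. openin (Euclidean_space n) U \<and>
       (\<forall>u\<in>U. \<exists>V q. openin (Euclidean_space n) V \<and> u \<in> V \<and> V \<subseteq> U \<and>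
          q \<in> plots X n V \<and> (\<forall>v\<in>V. p v = R `` {q v}))}\<rparr>"


section \<open>Diffeological groups and their coset spaces\<close>

locale diffeological_group = group G + diffeological_space D
  for G :: "('a, 'b) monoid_scheme" (structure) and D :: "'a diffeology" +
  assumes points_eq_carrier: "points D = carrier G"
    and smooth_mult:
      "(\<lambda>z \<in> carrier G \<times> carrier G. fst z \<otimes> snd z) \<in> smooth_maps (product_diffeology D D) D"
    and smooth_inv: "(\<lambda>x \<in> carrier G. inv x) \<in> smooth_maps D D"

definition left_coset_space ::
  "('a, 'b) monoid_scheme \<Rightarrow> 'a diffeology \<Rightarrow> 'a set \<Rightarrow> 'a set diffeology" where
  "left_coset_space G D H =
    quotient_diffeology D {(x, y). x \<in> carrier G \<and> y \<in> carrier G \<and> x <#\<^bsub>G\<^esub> H = y <#\<^bsub>G\<^esub> H}"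

definition right_coset_space ::
  "('a, 'b) monoid_scheme \<Rightarrow> 'a diffeology \<Rightarrow> 'a set \<Rightarrow> 'a set diffeology" where
  "right_coset_space G D H =
    quotient_diffeology D {(x, y). x \<in> carrier G \<and> y \<in> carrier G \<and> H #>\<^bsub>G\<^esub> x = H #>\<^bsub>G\<^esub> y}"

text \<open>The equivalence classes are indeed the cosets.\<close>

lemma left_coset_class:
  assumes "group G" "subgroup H G" "x \<in> carrier G"
  shows "{(x, y). x \<in> carrier G \<and> y \<in> carrier G \<and> x <#\<^bsub>G\<^esub> H = y <#\<^bsub>G\<^esub> H} `` {x} = x <#\<^bsub>G\<^esub> H"
proof -
  interpret group G by fact
  have sub: "H \<subseteq> carrier G" by (rule subgroup.subset[OF assms(2)])
  have 1: "y \<in> carrier G" if "y \<in> x <#\<^bsub>G\<^esub> H" for y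
    using l_coset_subset_G[OF sub assms(3)] that by (rule subsetD)
  have 2: "y \<in> y <#\<^bsub>G\<^esub> H" if "y \<in> carrier G" for y
    using subgroup.one_closed[OF assms(2)] r_one[OF that] unfolding l_coset_def by force
  have 3: "x <#\<^bsub>G\<^esub> H = y <#\<^bsub>G\<^esub> H" if "y \<in> x <#\<^bsub>G\<^esub> H" for y
    by (rule l_repr_independence[OF that assms(3,2)])
  show ?thesis using assms(3) 1 2 3 by blast
qed

lemma right_coset_class:
  assumes "group G" "subgroup H G" "x \<in> carrier G"
  shows "{(x, y). x \<in> carrier G \<and> y \<in> carrier G \<and> H #>\<^bsub>G\<^esub> x = H #>\<^bsub>G\<^esub> y} `` {x} = H #>\<^bsub>G\<^esub> x"
proof -
  interpret group G by fact
  have sub: "H \<subseteq> carrier G" by (rule subgroup.subset[OF assms(2)])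
  have 1: "y \<in> carrier G" if "y \<in> H #>\<^bsub>G\<^esub> x" for y
    using r_coset_subset_G[OF sub assms(3)] that by (rule subsetD)
  have 2: "y \<in> H #>\<^bsub>G\<^esub> y" if "y \<in> carrier G" for y
    by (rule rcos_self[OF that assms(2)])
  have 3: "H #>\<^bsub>G\<^esub> x = H #>\<^bsub>G\<^esub> y" if "y \<in> H #>\<^bsub>G\<^esub> x" for y
    by (rule repr_independence[OF that assms(3,2)])
  show ?thesis using assms(3) 1 2 3 by blast
qed

lemma points_left_coset_space:
  assumes "diffeological_group G D" "subgroup H G"
  shows "points (left_coset_space G D H) = (\<lambda>x. x <#\<^bsub>G\<^esub> H) ` carrier G"
proof -
  interpret diffeological_group G D by fact
  show ?thesis
    unfolding left_coset_space_def quotient_diffeology_def quotient_def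
    by (simp add: points_eq_carrier left_coset_class[OF is_group assms(2)] UNION_singleton_eq_range
        del: Image_Collect_case_prod Image_singleton)
qed

lemma points_right_coset_space:
  assumes "diffeological_group G D" "subgroup H G"
  shows "points (right_coset_space G D H) = rcosets\<^bsub>G\<^esub> H"
proof -
  interpret diffeological_group G D by fact
  show ?thesis
    unfolding right_coset_space_def quotient_diffeology_def quotient_def RCOSETS_def
    by (simp add: points_eq_carrier right_coset_class[OF is_group assms(2)] UNION_singleton_eq_range
        del: Image_Collect_case_prod Image_singleton)
qed


section \<open>Simplicial sets and Kan complexes\<close>

text \<open>\<open>\<Delta>_hom m n\<close> is the set of morphisms \<open>[m] \<rightarrow> [n]\<close> of the simplicial category.\<close>

definition \<Delta>_hom :: "nat \<Rightarrow> nat \<Rightarrow> (nat \<Rightarrow> nat) set" where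
  "\<Delta>_hom m n = {f \<in> {..m} \<rightarrow>\<^sub>E {..n}. mono_on {..m} f}"

text \<open>For \<open>f : [m] \<rightarrow> [n]\<close>, \<open>act K m n f\<close> is the induced map from \<open>n\<close>-simplices to \<open>m\<close>-simplices.\<close>

record 'a sset =
  simplices :: "nat \<Rightarrow> 'a set"
  act :: "nat \<Rightarrow> nat \<Rightarrow> (nat \<Rightarrow> nat) \<Rightarrow> 'a \<Rightarrow> 'a"

locale simplicial_set =
  fixes K :: "'a sset"
  assumes act_closed: "f \<in> \<Delta>_hom m n \<Longrightarrow> act K m n f \<in> simplices K n \<rightarrow> simplices K m"
    and act_id: "x \<in> simplices K n \<Longrightarrow> act K n n (\<lambda>i\<in>{..n}. i) x = x"
    and act_compose: "f \<in> \<Delta>_hom l m \<Longrightarrow> g \<in> \<Delta>_hom m n \<Longrightarrow> x \<in> simplices K n \<Longrightarrow>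
      act K l n (compose {..l} g f) x = act K l m f (act K m n g x)"

definition simplicial_map :: "'a sset \<Rightarrow> 'b sset \<Rightarrow> (nat \<Rightarrow> 'a \<Rightarrow> 'b) \<Rightarrow> bool" where
  "simplicial_map K L \<phi> \<longleftrightarrow>
    (\<forall>n. \<phi> n \<in> simplices K n \<rightarrow> simplices L n) \<and>
    (\<forall>m n. \<forall>f \<in> \<Delta>_hom m n. \<forall>x \<in> simplices K n. \<phi> m (act K m n f x) = act L m n f (\<phi> n x))"

definition std_simplex :: "nat \<Rightarrow> (nat \<Rightarrow> nat) sset" where
  "std_simplex n = \<lparr>simplices = \<lambda>m. \<Delta>_hom m n, act = \<lambda>l m f x. compose {..l} x f\<rparr>"

text \<open>The horn \<open>\<Lambda>\<^sup>n\<^sub>k\<close> is the union of the faces of \<open>\<Delta>\<^sup>n\<close> opposite to the vertices \<open>i \<noteq> k\<close>.\<close>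

definition horn :: "nat \<Rightarrow> nat \<Rightarrow> (nat \<Rightarrow> nat) sset" where
  "horn n k =
    \<lparr>simplices = \<lambda>m. {f \<in> \<Delta>_hom m n. \<exists>i\<le>n. i \<noteq> k \<and> i \<notin> f ` {..m}},
     act = \<lambda>l m f x. compose {..l} x f\<rparr>"

definition kan_complex :: "'a sset \<Rightarrow> bool" where
  "kan_complex K \<longleftrightarrow> simplicial_set K \<and>
    (\<forall>n\<ge>1. \<forall>k\<le>n. \<forall>\<phi>. simplicial_map (horn n k) K \<phi> \<longrightarrow>
      (\<exists>\<psi>. simplicial_map (std_simplex n) K \<psi> \<and>
        (\<forall>m. \<forall>x \<in> simplices (horn n k) m. \<psi> m x = \<phi> m x)))"


section \<open>The smooth singular simplicial set and fibrancy\<close>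

definition affine_diffeology :: "nat \<Rightarrow> (nat \<Rightarrow> real) diffeology" where
  "affine_diffeology n = sub_diffeology (euclidean_diffeology (Suc n))
    {x \<in> topspace (Euclidean_space (Suc n)). (\<Sum>i\<le>n. x i) = 1}"

definition affine_push :: "nat \<Rightarrow> (nat \<Rightarrow> nat) \<Rightarrow> (nat \<Rightarrow> real) \<Rightarrow> (nat \<Rightarrow> real)" where
  "affine_push n f x = (\<lambda>j. \<Sum>i | i \<le> n \<and> f i = j. x i)"

definition smooth_singular :: "'a diffeology \<Rightarrow> ((nat \<Rightarrow> real) \<Rightarrow> 'a) sset" where
  "smooth_singular X =
    \<lparr>simplices = \<lambda>n. smooth_maps (affine_diffeology n) X,
     act = \<lambda>m n f \<sigma>. compose (points (affine_diffeology m)) \<sigma> (affine_push m f)\<rparr>"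

definition fibrant :: "'a diffeology \<Rightarrow> bool" where
  "fibrant X \<longleftrightarrow> diffeological_space X \<and> kan_complex (smooth_singular X)"

end

theory Submission
  imports Defs
begin

text \<open>
  Right cosets of \<open>H\<close> in \<open>G\<close> are left cosets of \<open>H\<close> in the opposite group, so it suffices to treat the
  left cosets \<open>G/H\<close>. A horn in the singular simplicial set of \<open>G/H\<close> can be given by smooth maps \<open>\<tau>\<^sub>i\<close> for
  \<open>i \<noteq> k\<close> from the affine space to \<open>G/H\<close>, such that \<open>\<tau>\<^sub>i\<close> and \<open>\<tau>\<^sub>j\<close> agree where \<open>x\<^sub>i = x\<^sub>j = 0\<close>; a
  filler is one smooth map that agrees with \<open>\<tau>\<^sub>i\<close> where \<open>x\<^sub>i = 0\<close>, for all \<open>i \<noteq> k\<close>. The argument has two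
  parts.

  Lifting (\<open>left_coset_plot_lift\<close>, \<open>left_coset_smooth_map_lift\<close>): a smooth map \<open>p\<close> from \<open>\<real>\<^sup>n\<close> to \<open>G/H\<close>
  lifts to \<open>G\<close>. By definition of the quotient diffeology it lifts locally. If \<open>g\<^sub>1\<close> and \<open>g\<^sub>2\<close> lift \<open>p\<close> over
  \<open>U\<close> and \<open>W\<close>, and \<open>\<Phi> : W \<rightarrow> U \<inter> W\<close> is smooth, then \<open>x \<mapsto> g\<^sub>2(x) g\<^sub>2(\<Phi> x)\<^sup>-\<^sup>1 g\<^sub>1(\<Phi> x)\<close> is another lift over
  \<open>W\<close>, and it equals \<open>g\<^sub>1\<close> at the fixed points of \<open>\<Phi>\<close> (\<open>coset_lift_twist\<close>). Smooth cut-off functions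
  provide suitable \<open>\<Phi>\<close> between boxes. With them, local lifts are glued to lifts over bounded boxes,
  where a compactness argument is applied in one coordinate at a time, and then the lifts over an
  exhausting sequence of cubes are made to converge.

  Filling (\<open>fill_faces\<close>): a smooth \<open>F\<close> with values in \<open>G\<close> that induces every \<open>\<tau>\<^sub>i\<close> on the face \<open>x\<^sub>i = 0\<close>
  is built by adding one face after the other. If \<open>F\<close> is right on some of the faces, \<open>t\<close> lifts \<open>\<tau>\<^sub>j\<close>, and
  \<open>P\<close> is the retraction onto the face \<open>x\<^sub>j = 0\<close> that moves weight to the vertex \<open>k\<close>, then
  \<open>x \<mapsto> F(x) F(P x)\<^sup>-\<^sup>1 t(P x)\<close> is right on these faces and on the face \<open>x\<^sub>j = 0\<close>.
\<close>

section \<open>Open subsets of Euclidean space\<close>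

lemma continuous_map_Euclidean_coordinate:
  "continuous_map (Euclidean_space n) euclideanreal (\<lambda>x. x i)"
  unfolding Euclidean_space_def
  by (intro continuous_map_from_subtopology continuous_map_product_projection) auto

lemma openin_Euclidean_space_nhd:
  assumes "openin (Euclidean_space n) U" "x \<in> U"
  shows "\<exists>e>0. {y \<in> topspace (Euclidean_space n). \<forall>i<n. \<bar>y i - x i\<bar> < e} \<subseteq> U"
proof -
  obtain T where T: "openin (powertop_real UNIV) T" "U = T \<inter> {x. \<forall>i\<ge>n. x i = 0}"
    using assms(1) unfolding Euclidean_space_def openin_subtopology by blast
  then obtain W where W: "\<And>i. open (W i)" "x \<in> Pi\<^sub>E UNIV W" "Pi\<^sub>E UNIV W \<subseteq> T"
  proof -
    have "x \<in> T" using T(2) assms(2) by blast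
    from bspec[OF iffD1[OF openin_product_topology_alt T(1)] this]
    obtain W where "\<forall>i\<in>UNIV. openin euclideanreal (W i)" "x \<in> Pi\<^sub>E UNIV W" "Pi\<^sub>E UNIV W \<subseteq> T"
      by (elim exE conjE)
    then show ?thesis using that[of W] by simp
  qed
  have "\<exists>e>0. \<forall>t. \<bar>t - x i\<bar> < e \<longrightarrow> t \<in> W i" for i
  proof -
    have "x i \<in> W i" using W(2) by auto
    then show ?thesis
      using W(1)[of i] unfolding open_dist dist_real_def by blast
  qed
  then obtain e where e: "\<And>i. e i > 0" "\<And>i t. \<bar>t - x i\<bar> < e i \<Longrightarrow> t \<in> W i"
    by metis
  define d where "d = Min (insert 1 (e ` {..<n}))"
  have d: "d > 0" "\<And>i. i < n \<Longrightarrow> d \<le> e i"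
    unfolding d_def using e(1) by (auto simp: Min_gr_iff)
  have "y \<in> U" if y: "y \<in> topspace (Euclidean_space n)" "\<forall>i<n. \<bar>y i - x i\<bar> < d" for y
  proof -
    have y0: "y i = 0" "x i = 0" if "i \<ge> n" for i
      using y(1) assms(2) T(2) that by (auto simp: topspace_Euclidean_space)
    have "y i \<in> W i" for i
    proof (cases "i < n")
      case True
      then show ?thesis using y(2) d(2) e(2) by (meson order_less_le_trans)
    next
      case False
      then show ?thesis using y0[of i] e(1)[of i] e(2)[of "y i" i] by auto
    qed
    then have "y \<in> T" using W(3) by auto
    then show ?thesis using T(2) y0 by auto
  qed
  then show ?thesis using d(1) by blast
qed

text \<open>Only the coordinates below \<open>n\<close> of the bounds \<open>a\<close> and \<open>b\<close> matter.\<close>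

definition open_box :: "nat \<Rightarrow> (nat \<Rightarrow> real) \<Rightarrow> (nat \<Rightarrow> real) \<Rightarrow> (nat \<Rightarrow> real) set" where
  "open_box n a b = {x \<in> topspace (Euclidean_space n). \<forall>i<n. a i < x i \<and> x i < b i}"

lemma openin_open_box: "openin (Euclidean_space n) (open_box n a b)"
proof -
  have "openin (Euclidean_space n) {x \<in> topspace (Euclidean_space n). x i \<in> {a i<..<b i}}" for i
    by (rule openin_continuous_map_preimage[OF continuous_map_Euclidean_coordinate]) auto
  then have "openin (Euclidean_space n)
      ((\<Inter>i\<in>{..<n}. {x \<in> topspace (Euclidean_space n). x i \<in> {a i<..<b i}})
        \<inter> topspace (Euclidean_space n))"
    by (intro openin_INT) auto
  also have "\<dots> = open_box n a b"
    by (auto simp: open_box_def)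
  finally show ?thesis .
qed

lemma open_box_mono:
  assumes "\<And>i. i < n \<Longrightarrow> a' i \<le> a i" "\<And>i. i < n \<Longrightarrow> b i \<le> b' i"
  shows "open_box n a b \<subseteq> open_box n a' b'"
  unfolding open_box_def using assms by (auto intro: le_less_trans less_le_trans)

lemma eventually_update_in_open:
  assumes "openin (Euclidean_space n) U" "x \<in> U" "i < n"
  shows "\<forall>\<^sub>F t in nhds (x i). x(i := t) \<in> U"
proof -
  obtain e where e: "e > 0" "{y \<in> topspace (Euclidean_space n). \<forall>i<n. \<bar>y i - x i\<bar> < e} \<subseteq> U"
    using openin_Euclidean_space_nhd[OF assms(1,2)] by blast
  have "x \<in> topspace (Euclidean_space n)"
    using assms(1,2) openin_subset by blast
  then have "x(i := t) \<in> U" if "dist t (x i) < e" for t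
    using that e(1) assms(3) by (intro subsetD[OF e(2)])
      (auto simp: topspace_Euclidean_space dist_real_def)
  then show ?thesis
    using e(1) unfolding eventually_nhds_metric by blast
qed


section \<open>Smooth functions of several real variables\<close>

lemma Ck_on_imp_continuous_map:
  "Ck_on k n U f \<Longrightarrow> continuous_map (subtopology (Euclidean_space n) U) euclideanreal f"
  by (cases k) auto

lemma Ck_on_mono:
  assumes "Ck_on k n U f" "V \<subseteq> U"
  shows "Ck_on k n V f"
  using assms
proof (induction k arbitrary: f)
  case 0
  then show ?case by (auto intro: continuous_map_from_subtopology_mono)
next
  case (Suc k)
  then show ?case
    by (auto intro: continuous_map_from_subtopology_mono) (meson subsetD)
qed

lemma Ck_on_cong:
  assumes U: "openin (Euclidean_space n) U" and eq: "\<And>x. x \<in> U \<Longrightarrow> f x = g x" and f: "Ck_on k n U f"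
  shows "Ck_on k n U g"
proof -
  have cont: "continuous_map (subtopology (Euclidean_space n) U) euclideanreal g"
    using Ck_on_imp_continuous_map[OF f] by (rule continuous_map_eq) (auto simp: eq)
  show ?thesis
  proof (cases k)
    case 0
    then show ?thesis using cont by simp
  next
    case (Suc l)
    have "((\<lambda>t. g (x(i := t))) has_real_derivative d) (at (x i))"
      if "i < n" "x \<in> U" "((\<lambda>t. f (x(i := t))) has_real_derivative d) (at (x i))" for i x d
    proof -
      have "\<forall>\<^sub>F t in nhds (x i). f (x(i := t)) = g (x(i := t))"
        using eventually_update_in_open[OF U that(2,1)] by eventually_elim (rule eq)
      then show ?thesis
        using that(3) by (simp add: DERIV_cong_ev[OF refl _ refl])
    qed
    then show ?thesis
      using f cont unfolding Suc by simp meson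
  qed
qed

lemma Ck_on_const: "Ck_on k n U (\<lambda>x. c)"
proof (induction k arbitrary: c)
  case (Suc k)
  show ?case
    by (auto intro!: exI[of _ "\<lambda>x. 0"] Suc)
qed auto

lemma Ck_on_add:
  assumes "Ck_on k n U f" "Ck_on k n U g"
  shows "Ck_on k n U (\<lambda>x. f x + g x)"
  using assms
proof (induction k arbitrary: f g)
  case 0
  then show ?case by (auto intro: continuous_map_add)
next
  case (Suc k)
  show ?case
    unfolding Ck_on.simps
  proof (intro conjI allI impI)
    show "continuous_map (subtopology (Euclidean_space n) U) euclideanreal (\<lambda>x. f x + g x)"
      using Suc.prems by (auto intro: continuous_map_add)
  next
    fix i assume "i < n"
    then obtain f' g' where "Ck_on k n U f'" "Ck_on k n U g'"
      and "\<And>x. x \<in> U \<Longrightarrow> ((\<lambda>t. f (x(i := t))) has_real_derivative f' x) (at (x i))"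
      and "\<And>x. x \<in> U \<Longrightarrow> ((\<lambda>t. g (x(i := t))) has_real_derivative g' x) (at (x i))"
      using Suc.prems by auto metis
    then show "\<exists>h. Ck_on k n U h \<and>
        (\<forall>x\<in>U. ((\<lambda>t. f (x(i := t)) + g (x(i := t))) has_real_derivative h x) (at (x i)))"
      by (intro exI[of _ "\<lambda>x. f' x + g' x"]) (auto intro: Suc.IH DERIV_add)
  qed
qed

lemma Ck_on_sum:
  assumes "\<And>i. i \<in> I \<Longrightarrow> Ck_on k n U (f i)"
  shows "Ck_on k n U (\<lambda>x. \<Sum>i\<in>I. f i x)"
  using assms by (induction I rule: infinite_finite_induct) (auto intro: Ck_on_const Ck_on_add)

text \<open>Smoothness of a function of one real variable, witnessed by the sequence of its derivatives.\<close>

definition smooth_real :: "(real \<Rightarrow> real) \<Rightarrow> bool" where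
  "smooth_real f \<longleftrightarrow> (\<exists>D. D 0 = f \<and> (\<forall>j t. (D j has_real_derivative D (Suc j) t) (at t)))"

lemma smooth_real_affine: "smooth_real (\<lambda>t. a * t + c)"
proof -
  define D :: "nat \<Rightarrow> real \<Rightarrow> real"
    where "D j t = (if j = 0 then a * t + c else if j = 1 then a else 0)" for j t
  have D0: "D 0 = (\<lambda>t. a * t + c)" and DS: "D (Suc j) = (\<lambda>t. if j = 0 then a else 0)" for j
    by (auto simp: D_def)
  have "(D j has_real_derivative D (Suc j) t) (at t)" for j t
    by (cases j) (auto simp: D0 DS intro!: derivative_eq_intros)
  moreover note D0
  ultimately show ?thesis unfolding smooth_real_def by blast
qed

lemma smooth_real_shift:
  assumes "smooth_real f"
  shows "smooth_real (\<lambda>t. f (t - c) + c)"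
proof -
  obtain D where D: "D 0 = f" "\<And>j t. (D j has_real_derivative D (Suc j) t) (at t)"
    using assms unfolding smooth_real_def by blast
  have "((\<lambda>t. D j (t - c)) has_real_derivative D (Suc j) (t - c)) (at t)" for j t
    using DERIV_shift[of "D j" "D (Suc j) (t - c)" t "- c"] D(2)[of j "t - c"] by simp
  then have "((\<lambda>t. D j (t - c) + (if j = 0 then c else 0)) has_real_derivative
      D (Suc j) (t - c) + (if Suc j = 0 then c else 0)) (at t)" for j t
    by (rule DERIV_cong[OF DERIV_add[OF _ DERIV_const]]) simp
  then show ?thesis
    unfolding smooth_real_def
    by (intro exI[of _ "\<lambda>j t. D j (t - c) + (if j = 0 then c else 0)"]) (simp add: D(1))
qed

lemma smooth_real_coinduct:
  assumes "f \<in> S" and "\<And>g. g \<in> S \<Longrightarrow> \<exists>g'\<in>S. \<forall>t. (g has_real_derivative g' t) (at t)"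
  shows "smooth_real f"
proof -
  obtain d where d: "\<And>g. g \<in> S \<Longrightarrow> d g \<in> S \<and> (\<forall>t. (g has_real_derivative d g t) (at t))"
    using assms(2) by metis
  have "(d ^^ j) f \<in> S" for j
    by (induction j) (auto simp: assms(1) d)
  then show ?thesis
    unfolding smooth_real_def by (intro exI[of _ "\<lambda>j. (d ^^ j) f"]) (auto simp: d)
qed

lemma Ck_on_smooth_real:
  assumes "smooth_real f"
  shows "Ck_on k n U (\<lambda>x. f (x i))"
proof -
  obtain D where D: "D 0 = f" "\<And>j t. (D j has_real_derivative D (Suc j) t) (at t)"
    using assms unfolding smooth_real_def by blast
  have cont: "continuous_map (subtopology (Euclidean_space n) U) euclideanreal (\<lambda>x. D j (x i))" for j
  proof -
    have "continuous_on UNIV (D j)"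
      using D(2) DERIV_isCont continuous_at_imp_continuous_on by blast
    then have "continuous_map (Euclidean_space n) euclideanreal (D j \<circ> (\<lambda>x. x i))"
      by (intro continuous_map_compose[OF continuous_map_Euclidean_coordinate]) auto
    then show ?thesis
      by (simp add: o_def continuous_map_from_subtopology)
  qed
  have "Ck_on k n U (\<lambda>x. D j (x i))" for j
  proof (induction k arbitrary: j)
    case 0
    then show ?case by (simp add: cont)
  next
    case (Suc k)
    have "\<exists>g. Ck_on k n U g \<and>
        (\<forall>x\<in>U. ((\<lambda>t. D j ((x(i' := t)) i)) has_real_derivative g x) (at (x i')))" for i'
    proof (cases "i' = i")
      case True
      then show ?thesis using Suc[of "Suc j"] D(2) by auto
    next
      case False
      then show ?thesis by (intro exI[of _ "\<lambda>x. 0"]) (auto simp: Ck_on_const)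
    qed
    then show ?case using cont by simp
  qed
  from this[of 0] show ?thesis by (simp add: D(1))
qed

lemma Ck_on_coordinate: "Ck_on k n U (\<lambda>x. x i)"
  using Ck_on_smooth_real[OF smooth_real_affine[of 1 0], of k n U i] by simp


section \<open>A smooth cut-off function\<close>

text \<open>The functions \<open>t \<mapsto> t\<^sup>-\<^sup>m exp (-1/t)\<close>, extended by \<open>0\<close> to \<open>t \<le> 0\<close>. All derivatives of the one with
  \<open>m = 0\<close> are linear combinations of them.\<close>

definition flat_exp :: "nat \<Rightarrow> real \<Rightarrow> real" where
  "flat_exp m t = (if t > 0 then exp (- 1 / t) / t ^ m else 0)"

lemma flat_exp_over_t_tendsto_0: "((\<lambda>t. flat_exp m t / t) \<longlongrightarrow> 0) (at 0)"
proof -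
  have "((\<lambda>s::real. s ^ Suc m / exp s) \<longlongrightarrow> 0) at_top"
    by (rule tendsto_power_div_exp_0)
  then have "((\<lambda>t::real. (inverse t) ^ Suc m / exp (inverse t)) \<longlongrightarrow> 0) (at_right 0)"
    by (rule filterlim_compose[OF _ filterlim_inverse_at_top_right])
  moreover have "\<forall>\<^sub>F t in at_right (0::real). (inverse t) ^ Suc m / exp (inverse t) = flat_exp m t / t"
    using eventually_at_right_less[of "0::real"]
    by eventually_elim (simp add: flat_exp_def exp_minus field_simps)
  ultimately have r: "((\<lambda>t. flat_exp m t / t) \<longlongrightarrow> 0) (at_right 0)"
    by (rule Lim_transform_eventually)
  have "\<forall>\<^sub>F t in at_left (0::real). 0 = flat_exp m t / t"
    using eventually_at_left_real[of "-1" "0::real", simplified]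
    by (rule eventually_mono) (auto simp: flat_exp_def)
  then have l: "((\<lambda>t. flat_exp m t / t) \<longlongrightarrow> 0) (at_left 0)"
    by (rule Lim_transform_eventually[OF tendsto_const])
  show ?thesis using l r by (simp add: filterlim_at_split)
qed

lemma DERIV_flat_exp:
  "(flat_exp m has_real_derivative flat_exp (m + 2) t - real m * flat_exp (m + 1) t) (at t)"
proof -
  consider "t > 0" | "t < 0" | "t = 0" by linarith
  then show ?thesis
  proof cases
    case 1
    have "((\<lambda>t. exp (- 1 / t) / t ^ m) has_real_derivative
        flat_exp (m + 2) t - real m * flat_exp (m + 1) t) (at t)"
    proof -
      have "(\<lambda>t. exp (- 1 / t) / t ^ m) = (\<lambda>t::real. exp (- 1 / t) * inverse t ^ m)"
        by (simp add: fun_eq_iff divide_inverse power_inverse)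
      moreover have "((\<lambda>t. exp (- 1 / t) * inverse t ^ m) has_real_derivative
          exp (- 1 / t) * (inverse t * inverse t) * inverse t ^ m
          + exp (- 1 / t) * (real m * inverse t ^ (m - 1) * (- (inverse t * inverse t)))) (at t)"
        using 1 by (auto intro!: derivative_eq_intros simp: divide_inverse power2_eq_square)
      moreover have "exp (- 1 / t) * (inverse t * inverse t) * inverse t ^ m
          + exp (- 1 / t) * (real m * inverse t ^ (m - 1) * (- (inverse t * inverse t)))
          = flat_exp (m + 2) t - real m * flat_exp (m + 1) t"
        using 1 by (cases m) (auto simp: flat_exp_def divide_inverse power_inverse)
      ultimately show ?thesis by simp
    qed
    then show ?thesis
      by (rule has_field_derivative_transform_within_open[of _ _ _ "{0<..}"])
        (use 1 in \<open>auto simp: flat_exp_def\<close>)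
  next
    case 2
    have "((\<lambda>t. 0) has_real_derivative 0) (at t)" by simp
    then have "(flat_exp m has_real_derivative 0) (at t)"
      by (rule has_field_derivative_transform_within_open[of _ _ _ "{..<0}"])
        (use 2 in \<open>auto simp: flat_exp_def\<close>)
    then show ?thesis using 2 by (simp add: flat_exp_def)
  next
    case 3
    then show ?thesis
      using flat_exp_over_t_tendsto_0[of m] by (simp add: DERIV_def flat_exp_def)
  qed
qed

text \<open>The algebra generated by the ingredients of the cut-off function below. Including all the functions
  \<open>flat_exp m\<close> and the reciprocal makes it closed under differentiation.\<close>

inductive_set cutoff_algebra :: "real \<Rightarrow> real \<Rightarrow> (real \<Rightarrow> real) set" for M b where
  const: "(\<lambda>t. c) \<in> cutoff_algebra M b"
| ident: "(\<lambda>t. t) \<in> cutoff_algebra M b"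
| flat: "(\<lambda>t. flat_exp m (t\<^sup>2 - b\<^sup>2)) \<in> cutoff_algebra M b"
| recip: "(\<lambda>t. 1 / (1 + M * t\<^sup>2 * flat_exp 0 (t\<^sup>2 - b\<^sup>2))) \<in> cutoff_algebra M b"
| add: "f \<in> cutoff_algebra M b \<Longrightarrow> g \<in> cutoff_algebra M b \<Longrightarrow> (\<lambda>t. f t + g t) \<in> cutoff_algebra M b"
| mult: "f \<in> cutoff_algebra M b \<Longrightarrow> g \<in> cutoff_algebra M b \<Longrightarrow> (\<lambda>t. f t * g t) \<in> cutoff_algebra M b"

lemma cutoff_algebra_deriv:
  assumes "M \<ge> 0" "f \<in> cutoff_algebra M b"
  shows "\<exists>f'\<in>cutoff_algebra M b. \<forall>t. (f has_real_derivative f' t) (at t)"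
  using assms(2)
proof induction
  case (const c)
  show ?case by (intro bexI[of _ "\<lambda>t. 0"]) (auto intro: cutoff_algebra.const)
next
  case ident
  show ?case by (intro bexI[of _ "\<lambda>t. 1"]) (auto intro: cutoff_algebra.const)
next
  case (flat m)
  let ?f = "\<lambda>t. (flat_exp (m + 2) (t\<^sup>2 - b\<^sup>2) + (- real m) * flat_exp (m + 1) (t\<^sup>2 - b\<^sup>2)) * (2 * t)"
  have "?f \<in> cutoff_algebra M b"
    by (intro cutoff_algebra.intros)
  moreover have "((\<lambda>t. flat_exp m (t\<^sup>2 - b\<^sup>2)) has_real_derivative ?f t) (at t)" for t
    by (rule DERIV_chain2[of "flat_exp m" _ "\<lambda>t. t\<^sup>2 - b\<^sup>2", THEN DERIV_cong, OF DERIV_flat_exp])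
      (auto intro!: derivative_eq_intros)
  ultimately show ?case by (intro bexI[of _ ?f]) simp_all
next
  case recip
  let ?e = "\<lambda>t. flat_exp 0 (t\<^sup>2 - b\<^sup>2)"
  let ?r = "\<lambda>t. 1 / (1 + M * t\<^sup>2 * ?e t)"
  let ?u' = "\<lambda>t. M * (2 * t) * ?e t + M * (t * t) * (flat_exp 2 (t\<^sup>2 - b\<^sup>2) * (2 * t))"
  have pos: "1 + M * t\<^sup>2 * ?e t > 0" for t
    using assms(1) by (intro add_pos_nonneg mult_nonneg_nonneg) (auto simp: flat_exp_def)
  have "(\<lambda>t. ((- 1) * (?r t * ?r t)) * ?u' t) \<in> cutoff_algebra M b"
    by (intro cutoff_algebra.intros)
  moreover have "(?r has_real_derivative ((- 1) * (?r t * ?r t)) * ?u' t) (at t)" for t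
  proof -
    have "(?e has_real_derivative flat_exp 2 (t\<^sup>2 - b\<^sup>2) * (2 * t)) (at t)"
      by (rule DERIV_chain2[of "flat_exp 0" _ "\<lambda>t. t\<^sup>2 - b\<^sup>2", THEN DERIV_cong, OF DERIV_flat_exp])
        (auto intro!: derivative_eq_intros simp flip: numeral_2_eq_2)
    then have u: "((\<lambda>t. 1 + M * t\<^sup>2 * ?e t) has_real_derivative ?u' t) (at t)"
      by (auto intro!: derivative_eq_intros simp: power2_eq_square algebra_simps)
    show ?thesis
      using pos[of t] by (intro DERIV_cong[OF DERIV_divide[OF DERIV_const u]]) (simp_all add: divide_simps)
  qed
  ultimately show ?case by (intro bexI[of _ "\<lambda>t. ((- 1) * (?r t * ?r t)) * ?u' t"]) simp_all
next
  case (add f g)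
  then obtain f' g' where "f' \<in> cutoff_algebra M b" "g' \<in> cutoff_algebra M b"
    "\<And>t. (f has_real_derivative f' t) (at t)" "\<And>t. (g has_real_derivative g' t) (at t)"
    by blast
  then show ?case
    by (intro bexI[of _ "\<lambda>t. f' t + g' t"]) (auto intro: cutoff_algebra.add DERIV_add)
next
  case (mult f g)
  then obtain f' g' where "f' \<in> cutoff_algebra M b" "g' \<in> cutoff_algebra M b"
    "\<And>t. (f has_real_derivative f' t) (at t)" "\<And>t. (g has_real_derivative g' t) (at t)"
    by blast
  then show ?case
    using mult.hyps
    by (intro bexI[of _ "\<lambda>t. f' t * g t + g' t * f t"])
      (auto intro!: cutoff_algebra.add cutoff_algebra.mult DERIV_mult)
qed

text \<open>The function is \<open>t / (1 + M t\<^sup>2 e(t))\<close>, moved to the centre \<open>c\<close>, where \<open>e(t) = exp (-1 / (t\<^sup>2 - b\<^sup>2))\<close>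
  for \<open>\<bar>t\<bar> > b\<close> and \<open>e(t) = 0\<close> otherwise. A large \<open>M\<close> keeps it below \<open>b'\<close>.\<close>

lemma smooth_cutoff_exists:
  assumes "0 < b" "b < b'"
  shows "\<exists>\<rho>. smooth_real \<rho> \<and> (\<forall>t. \<bar>t - c\<bar> \<le> b \<longrightarrow> \<rho> t = t) \<and> (\<forall>t. \<bar>\<rho> t - c\<bar> < b')"
proof -
  define \<beta> where "\<beta> = (b + b') / 2"
  have \<beta>: "b < \<beta>" "\<beta> < b'" "0 < \<beta>" using assms by (auto simp: \<beta>_def)
  define \<epsilon> where "\<epsilon> = flat_exp 0 (\<beta>\<^sup>2 - b\<^sup>2)"
  have sq: "\<beta>\<^sup>2 - b\<^sup>2 > 0" using \<beta> assms(1) by (simp add: power_strict_mono)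
  then have \<epsilon>: "\<epsilon> > 0" by (simp add: \<epsilon>_def flat_exp_def)
  \<comment> \<open>for \<open>\<bar>t\<bar> \<ge> \<beta>\<close> the absolute value of the function is at most \<open>1 / (M \<bar>t\<bar> \<epsilon>)\<close>, hence at most
    \<open>\<beta>\<close> for this choice of \<open>M\<close>\<close>
  define M where "M = 1 / (\<beta>\<^sup>2 * \<epsilon>)"
  have M: "M > 0" using \<epsilon> \<beta> by (simp add: M_def)
  define u where "u t = 1 + M * t\<^sup>2 * flat_exp 0 (t\<^sup>2 - b\<^sup>2)" for t
  define \<rho> where "\<rho> t = t * (1 / u t)" for t
  have "\<rho> \<in> cutoff_algebra M b"
    unfolding \<rho>_def u_def by (intro cutoff_algebra.intros)
  then have smooth: "smooth_real \<rho>"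
    using smooth_real_coinduct[of \<rho> "cutoff_algebra M b"] cutoff_algebra_deriv M by (simp add: less_imp_le)
  have u1: "u t \<ge> 1" for t
    using M by (auto simp: u_def flat_exp_def)
  have id: "\<rho> t = t" if "\<bar>t\<bar> \<le> b" for t
  proof -
    have "t\<^sup>2 - b\<^sup>2 \<le> 0"
      using that by (metis abs_le_square_iff abs_of_pos assms(1) diff_le_0_iff_le)
    then show ?thesis by (simp add: \<rho>_def u_def flat_exp_def)
  qed
  have bound: "\<bar>\<rho> t\<bar> \<le> \<beta>" for t
  proof (cases "\<bar>t\<bar> \<le> \<beta>")
    case True
    have "\<bar>\<rho> t\<bar> \<le> \<bar>t\<bar> / 1"
      unfolding \<rho>_def using u1[of t] by (simp add: abs_mult field_simps mult_left_le_one_le)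
        (metis abs_ge_zero mult_left_mono mult.right_neutral)
    then show ?thesis using True by simp
  next
    case False
    then have t: "\<bar>t\<bar> > \<beta>" by simp
    then have tsq: "t\<^sup>2 \<ge> \<beta>\<^sup>2" using \<beta>(3) by (simp flip: abs_le_square_iff)
    have "flat_exp 0 (t\<^sup>2 - b\<^sup>2) \<ge> \<epsilon>"
      using sq tsq by (simp add: \<epsilon>_def flat_exp_def frac_le)
    then have "u t \<ge> M * t\<^sup>2 * \<epsilon>"
      unfolding u_def using M by (smt (verit) mult_left_mono mult_nonneg_nonneg zero_le_power2)
    also have "M * t\<^sup>2 * \<epsilon> = \<bar>t\<bar> * \<bar>t\<bar> / \<beta>\<^sup>2"
      using \<epsilon> by (simp add: M_def power2_eq_square)
    also have "\<dots> \<ge> \<bar>t\<bar> / \<beta>"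
      using t \<beta>(3) mult_right_mono[of \<beta> "\<bar>t\<bar>" "\<bar>t\<bar>"]
      by (simp add: power2_eq_square divide_simps mult.commute)
    finally show ?thesis
      unfolding \<rho>_def using u1[of t] \<beta>(3) by (simp add: abs_mult field_simps)
  qed
  show ?thesis
    using smooth_real_shift[OF smooth, of c] id bound \<beta>(2)
    by (intro exI[of _ "\<lambda>t. \<rho> (t - c) + c"]) (auto intro: le_less_trans)
qed


section \<open>Plots\<close>

lemma smooth_betweenD:
  assumes "smooth_between n U m V f"
  shows "openin (Euclidean_space n) U" "openin (Euclidean_space m) V"
    "\<And>x. x \<in> U \<Longrightarrow> f x \<in> V" "\<And>j k. j < m \<Longrightarrow> Ck_on k n U (\<lambda>x. f x j)"
  using assms unfolding smooth_between_def by auto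

lemma smooth_between_cong:
  assumes "smooth_between n U m V f" "\<And>x. x \<in> U \<Longrightarrow> f x = g x"
  shows "smooth_between n U m V g"
  unfolding smooth_between_def
proof (intro conjI allI impI)
  show "openin (Euclidean_space n) U" "openin (Euclidean_space m) V"
    using assms(1) by (auto dest: smooth_betweenD)
  show "g \<in> U \<rightarrow> V"
    using smooth_betweenD(3)[OF assms(1)] assms(2) by auto
  show "Ck_on k n U (\<lambda>x. g x j)" if "j < m" for j k
    using assms(2) by (intro Ck_on_cong[OF smooth_betweenD(1)[OF assms(1)] _ smooth_betweenD(4)[OF assms(1) that]]) auto
qed

lemma smooth_between_codomain_mono:
  assumes "smooth_between n U m V f" "V \<subseteq> V'" "openin (Euclidean_space m) V'"
  shows "smooth_between n U m V' f"
  using assms unfolding smooth_between_def by auto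

lemma smooth_between_inclusion:
  assumes "openin (Euclidean_space n) V" "openin (Euclidean_space n) U" "V \<subseteq> U"
  shows "smooth_between n V n U (\<lambda>x. x)"
  using assms unfolding smooth_between_def by (auto intro: Ck_on_coordinate)

lemma smooth_between_coordinatewise:
  assumes "openin (Euclidean_space n) U" "openin (Euclidean_space n) V"
    and "\<And>i. i < n \<Longrightarrow> smooth_real (f i)"
    and "\<And>x. x \<in> U \<Longrightarrow> (\<lambda>i. if i < n then f i (x i) else 0) \<in> V"
  shows "smooth_between n U n V (\<lambda>x i. if i < n then f i (x i) else 0)"
  using assms unfolding smooth_between_def by (auto intro: Ck_on_smooth_real)

lemma smooth_between_openin_preimage:
  assumes "smooth_between n U m V f" "openin (Euclidean_space m) W"
  shows "openin (Euclidean_space n) {x \<in> U. f x \<in> W}"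
proof -
  have "continuous_map (subtopology (Euclidean_space n) U) (Euclidean_space m)
      (\<lambda>x i. if i < m then f x i else 0)"
    unfolding continuous_map_componentwise_Euclidean_space
    using smooth_betweenD(4)[OF assms(1)] Ck_on_imp_continuous_map by blast
  moreover have "V \<subseteq> topspace (Euclidean_space m)"
    using smooth_betweenD(2)[OF assms(1)] openin_subset by blast
  then have "(\<lambda>i. if i < m then f x i else 0) = f x" if "x \<in> U" for x
    using smooth_betweenD(3)[OF assms(1) that] by (auto simp: fun_eq_iff topspace_Euclidean_space)
  ultimately have "continuous_map (subtopology (Euclidean_space n) U) (Euclidean_space m) f"
    by (rule continuous_map_eq) auto
  then have "openin (subtopology (Euclidean_space n) U)
      {x \<in> topspace (subtopology (Euclidean_space n) U). f x \<in> W}"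
    using assms(2) by (rule openin_continuous_map_preimage)
  moreover have "topspace (subtopology (Euclidean_space n) U) = U"
    using openin_subset[OF smooth_betweenD(1)[OF assms(1)]] by auto
  ultimately show ?thesis
    using openin_open_subtopology[OF smooth_betweenD(1)[OF assms(1)]] by metis
qed

lemma (in diffeological_space) plot_restrict:
  assumes "p \<in> plots X n U" "openin (Euclidean_space n) V" "V \<subseteq> U"
  shows "restrict p V \<in> plots X n V"
  using plot_compose[OF assms(1) smooth_between_inclusion[OF assms(2) plot_domain[OF assms(1)] assms(3)]]
  by (simp add: compose_def restrict_def)

lemma (in diffeological_space) plot_closed:
  "p \<in> plots X n U \<Longrightarrow> u \<in> U \<Longrightarrow> p u \<in> points X"
  using plot_function by blast

lemma diffeological_space_quotient:
  assumes "diffeological_space X"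
  shows "diffeological_space (quotient_diffeology X R)"
proof
  interpret diffeological_space X by fact
  let ?Q = "quotient_diffeology X R"
  have pts: "points ?Q = points X // R" by (simp add: quotient_diffeology_def)
  have plot_iff: "p \<in> plots ?Q n U \<longleftrightarrow> p \<in> U \<rightarrow>\<^sub>E points X // R \<and> openin (Euclidean_space n) U \<and>
       (\<forall>u\<in>U. \<exists>V q. openin (Euclidean_space n) V \<and> u \<in> V \<and> V \<subseteq> U \<and>
          q \<in> plots X n V \<and> (\<forall>v\<in>V. p v = R `` {q v}))" for p n U
    by (simp add: quotient_diffeology_def)
  show "openin (Euclidean_space n) U" if "p \<in> plots ?Q n U" for p n U
    using that unfolding plot_iff by blast
  show "p \<in> U \<rightarrow>\<^sub>E points ?Q" if "p \<in> plots ?Q n U" for p n U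
    using that unfolding plot_iff pts by blast
  show "(\<lambda>u\<in>U. c) \<in> plots ?Q n U" if U: "openin (Euclidean_space n) U" and c: "c \<in> points ?Q" for n U c
  proof -
    obtain x where x: "x \<in> points X" "c = R `` {x}"
      using c unfolding pts by (auto elim: quotientE)
    have "\<exists>V q. openin (Euclidean_space n) V \<and> u \<in> V \<and> V \<subseteq> U \<and>
          q \<in> plots X n V \<and> (\<forall>v\<in>V. (\<lambda>u\<in>U. c) v = R `` {q v})" if "u \<in> U" for u
      using that U plot_const[OF U x(1)] x(2) by (intro exI[of _ U] exI[of _ "\<lambda>u\<in>U. x"]) auto
    then show ?thesis
      using U c unfolding plot_iff pts by auto
  qed
  show "compose V p h \<in> plots ?Q m V"
    if p: "p \<in> plots ?Q n U" and h: "smooth_between m V n U h" for p n U m V h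
    unfolding plot_iff
  proof (intro conjI ballI)
    show "openin (Euclidean_space m) V" using h by (rule smooth_betweenD)
    show "compose V p h \<in> V \<rightarrow>\<^sub>E points X // R"
      using p smooth_betweenD(3)[OF h] unfolding plot_iff by (auto simp: compose_def)
    fix v assume v: "v \<in> V"
    then obtain W q where W: "openin (Euclidean_space n) W" "h v \<in> W" "W \<subseteq> U"
      and q: "q \<in> plots X n W" "\<And>w. w \<in> W \<Longrightarrow> p w = R `` {q w}"
      using p smooth_betweenD(3)[OF h] unfolding plot_iff by meson
    define V' where "V' = {x \<in> V. h x \<in> W}"
    have V': "openin (Euclidean_space m) V'"
      unfolding V'_def by (rule smooth_between_openin_preimage[OF h W(1)])
    have "smooth_between m V' n W h"
      using h V' W(1) unfolding smooth_between_def V'_def by (auto intro: Ck_on_mono)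
    then have "compose V' q h \<in> plots X m V'"
      by (rule plot_compose[OF q(1)])
    moreover have "compose V p h x = R `` {compose V' q h x}" if "x \<in> V'" for x
      using that q(2) by (simp add: compose_def V'_def)
    ultimately show "\<exists>V' q. openin (Euclidean_space m) V' \<and> v \<in> V' \<and> V' \<subseteq> V \<and>
        q \<in> plots X m V' \<and> (\<forall>x\<in>V'. compose V p h x = R `` {q x})"
      using V' v W(2) unfolding V'_def by blast
  qed
  show "p \<in> plots ?Q n U"
    if U: "openin (Euclidean_space n) U" and p: "p \<in> U \<rightarrow>\<^sub>E points ?Q" and cover: "\<Union>\<V> = U"
      and plots: "\<And>V. V \<in> \<V> \<Longrightarrow> restrict p V \<in> plots ?Q n V" for n U p \<V>
    unfolding plot_iff
  proof (intro conjI ballI)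
    show "openin (Euclidean_space n) U" "p \<in> U \<rightarrow>\<^sub>E points X // R"
      using U p by (simp_all add: pts)
    fix u assume "u \<in> U"
    then obtain V where V: "V \<in> \<V>" "u \<in> V" using cover by blast
    then obtain W q where "openin (Euclidean_space n) W" "u \<in> W" "W \<subseteq> V"
      "q \<in> plots X n W" "\<forall>w\<in>W. restrict p V w = R `` {q w}"
      using plots[OF V(1)] unfolding plot_iff by meson
    moreover have "restrict p V w = p w" if "w \<in> W" for w
      using that \<open>W \<subseteq> V\<close> by auto
    ultimately show "\<exists>V q. openin (Euclidean_space n) V \<and> u \<in> V \<and> V \<subseteq> U \<and>
        q \<in> plots X n V \<and> (\<forall>v\<in>V. p v = R `` {q v})"
      using V(1) cover by (intro exI[of _ W] exI[of _ q]) auto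
  qed
qed

context diffeological_group
begin

lemma plot_mult:
  assumes "p \<in> plots D n U" "q \<in> plots D n U"
  shows "(\<lambda>u\<in>U. p u \<otimes> q u) \<in> plots D n U"
proof -
  have pq: "p \<in> U \<rightarrow>\<^sub>E carrier G" "q \<in> U \<rightarrow>\<^sub>E carrier G"
    using plot_function[OF assms(1)] plot_function[OF assms(2)] by (simp_all add: points_eq_carrier)
  have "compose U fst (\<lambda>u\<in>U. (p u, q u)) = p" "compose U snd (\<lambda>u\<in>U. (p u, q u)) = q"
    using pq by (auto simp: compose_def fun_eq_iff PiE_def extensional_def)
  then have "(\<lambda>u\<in>U. (p u, q u)) \<in> plots (product_diffeology D D) n U"
    using assms pq by (auto simp: product_diffeology_def points_eq_carrier)
  then have "compose U (\<lambda>z \<in> carrier G \<times> carrier G. fst z \<otimes> snd z) (\<lambda>u\<in>U. (p u, q u)) \<in> plots D n U"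
    using smooth_mult unfolding smooth_maps_def by blast
  also have "compose U (\<lambda>z \<in> carrier G \<times> carrier G. fst z \<otimes> snd z) (\<lambda>u\<in>U. (p u, q u)) =
      (\<lambda>u\<in>U. p u \<otimes> q u)"
    using pq by (auto simp: compose_def fun_eq_iff)
  finally show ?thesis .
qed

lemma plot_inv:
  assumes "p \<in> plots D n U"
  shows "(\<lambda>u\<in>U. inv (p u)) \<in> plots D n U"
proof -
  have "compose U (\<lambda>x \<in> carrier G. inv x) p \<in> plots D n U"
    using smooth_inv assms unfolding smooth_maps_def by blast
  also have "compose U (\<lambda>x \<in> carrier G. inv x) p = (\<lambda>u\<in>U. inv (p u))"
    using plot_closed[OF assms] by (auto simp: compose_def fun_eq_iff points_eq_carrier)
  finally show ?thesis .
qed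

end


section \<open>Lifting maps from cosets to the group\<close>

text \<open>A diffeological group \<open>G\<close> with a subgroup \<open>H\<close>, for the study of its left cosets.\<close>

locale homogeneous_space = diffeological_group G D
  for G :: "('a, 'b) monoid_scheme" (structure) and D :: "'a diffeology" +
  fixes H :: "'a set"
  assumes subgroup_H: "subgroup H G"
begin

lemma coset_eq_iff:
  assumes "x \<in> carrier G" "y \<in> carrier G"
  shows "x <# H = y <# H \<longleftrightarrow> (\<exists>h\<in>H. y = x \<otimes> h)"
proof
  assume "x <# H = y <# H"
  moreover have "y \<in> y <# H"
    using subgroup.one_closed[OF subgroup_H] assms(2) unfolding l_coset_def by force
  ultimately show "\<exists>h\<in>H. y = x \<otimes> h" unfolding l_coset_def by auto
next
  assume "\<exists>h\<in>H. y = x \<otimes> h"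
  then have "y \<in> x <# H" unfolding l_coset_def by auto
  then show "x <# H = y <# H"
    using assms(1) subgroup_H by (rule l_repr_independence)
qed

lemma coset_twist:
  assumes "a \<in> carrier G" "b \<in> carrier G" "c \<in> carrier G" "b <# H = c <# H"
  shows "(a \<otimes> inv b \<otimes> c) <# H = a <# H"
proof -
  obtain h where h: "h \<in> H" "c = b \<otimes> h"
    using assms coset_eq_iff by blast
  have hG: "h \<in> carrier G" using h(1) subgroup.subset[OF subgroup_H] by blast
  have "inv b \<otimes> (b \<otimes> h) = h"
    using assms(2) hG by (simp flip: m_assoc)
  then have "a \<otimes> inv b \<otimes> c = a \<otimes> h"
    using assms(1,2) hG unfolding h(2) by (simp add: m_assoc)
  then show ?thesis
    using coset_eq_iff[of a "a \<otimes> h"] h(1) hG assms(1) by auto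
qed

text \<open>\<open>g\<close> is a plot of the group over \<open>U\<close> lifting \<open>p\<close>, a map to the left cosets of \<open>H\<close>.\<close>

definition coset_lift :: "((nat \<Rightarrow> real) \<Rightarrow> 'a set) \<Rightarrow> nat \<Rightarrow> (nat \<Rightarrow> real) set \<Rightarrow> ((nat \<Rightarrow> real) \<Rightarrow> 'a) \<Rightarrow> bool"
  where "coset_lift p n U g \<longleftrightarrow> g \<in> plots D n U \<and> (\<forall>u\<in>U. p u = g u <# H)"

lemma coset_lift_carrier: "coset_lift p n U g \<Longrightarrow> u \<in> U \<Longrightarrow> g u \<in> carrier G"
  unfolding coset_lift_def using plot_closed points_eq_carrier by blast

lemma coset_lift_restrict:
  assumes "coset_lift p n U g" "openin (Euclidean_space n) V" "V \<subseteq> U"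
  shows "coset_lift p n V (restrict g V)"
  using assms plot_restrict unfolding coset_lift_def by auto

lemma coset_lift_local:
  assumes "g \<in> extensional U" "openin (Euclidean_space n) U" "\<Union>\<V> = U"
    and "\<And>V. V \<in> \<V> \<Longrightarrow> coset_lift p n V (restrict g V)"
  shows "coset_lift p n U g"
proof -
  have V: "\<exists>V\<in>\<V>. u \<in> V \<and> coset_lift p n V (restrict g V)" if "u \<in> U" for u
    using that assms(3,4) by blast
  have "g u \<in> points D" if u: "u \<in> U" for u
  proof -
    obtain V where "u \<in> V" "coset_lift p n V (restrict g V)" using V[OF u] by blast
    then show ?thesis using coset_lift_carrier[of p n V "restrict g V" u] by (simp add: points_eq_carrier)
  qed
  moreover have "openin (Euclidean_space n) V" "restrict g V \<in> plots D n V" if "V \<in> \<V>" for V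
    using assms(4)[OF that] plot_domain unfolding coset_lift_def by blast+
  ultimately have "g \<in> plots D n U"
    using assms(1-3) by (intro plot_local[of n U g \<V>]) (auto simp: PiE_def)
  moreover have "p u = g u <# H" if u: "u \<in> U" for u
  proof -
    obtain V where "u \<in> V" "coset_lift p n V (restrict g V)" using V[OF u] by blast
    then show ?thesis unfolding coset_lift_def by auto
  qed
  ultimately show ?thesis unfolding coset_lift_def by blast
qed

text \<open>Two lifts over \<open>U \<inter> W\<close> differ by a map to \<open>H\<close>. Pulling this difference back along a map
  \<open>\<Phi> : W \<rightarrow> U \<inter> W\<close> corrects the lift over \<open>W\<close> so that it agrees with the lift over \<open>U\<close> wherever
  \<open>\<Phi>\<close> is the identity.\<close>

lemma coset_lift_twist:
  assumes g1: "coset_lift p n U g1" and g2: "coset_lift p n W g2"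
    and \<Phi>: "smooth_between n W n (U \<inter> W) \<Phi>"
  shows "\<exists>g. coset_lift p n W g \<and> (\<forall>x\<in>W. \<Phi> x = x \<longrightarrow> g x = g1 x)"
proof -
  let ?g = "\<lambda>x\<in>W. g2 x \<otimes> inv (g2 (\<Phi> x)) \<otimes> g1 (\<Phi> x)"
  have plots: "g1 \<in> plots D n U" "g2 \<in> plots D n W"
    using g1 g2 by (auto simp: coset_lift_def)
  have \<Phi>': "smooth_between n W n U \<Phi>" "smooth_between n W n W \<Phi>"
    using plots[THEN plot_domain] by (auto intro: smooth_between_codomain_mono[OF \<Phi>])
  have \<Phi>W: "\<Phi> x \<in> U" "\<Phi> x \<in> W" if "x \<in> W" for x
    using smooth_betweenD(3)[OF \<Phi> that] by auto
  have c: "g2 x \<in> carrier G" "g2 (\<Phi> x) \<in> carrier G" "g1 (\<Phi> x) \<in> carrier G" if "x \<in> W" for x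
    using that \<Phi>W coset_lift_carrier[OF g1] coset_lift_carrier[OF g2] by auto
  have "(\<lambda>x\<in>W. (\<lambda>x\<in>W. g2 x \<otimes> (\<lambda>x\<in>W. inv (compose W g2 \<Phi> x)) x) x \<otimes> compose W g1 \<Phi> x)
      \<in> plots D n W"
    by (intro plot_mult plot_inv plot_compose[OF plots(1) \<Phi>'(1)] plot_compose[OF plots(2) \<Phi>'(2)] plots)
  also have "(\<lambda>x\<in>W. (\<lambda>x\<in>W. g2 x \<otimes> (\<lambda>x\<in>W. inv (compose W g2 \<Phi> x)) x) x \<otimes> compose W g1 \<Phi> x) = ?g"
    by (auto simp: compose_def fun_eq_iff)
  finally have "?g \<in> plots D n W" .
  moreover have "p x = ?g x <# H" if x: "x \<in> W" for x
  proof -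
    have "g2 (\<Phi> x) <# H = g1 (\<Phi> x) <# H"
      using g1 g2 \<Phi>W[OF x] unfolding coset_lift_def by metis
    then show ?thesis
      using coset_twist c[OF x] x g2 unfolding coset_lift_def by simp
  qed
  moreover have "?g x = g1 x" if "x \<in> W" "\<Phi> x = x" for x
    using that c[OF that(1)] by simp
  ultimately show ?thesis
    unfolding coset_lift_def by blast
qed

text \<open>Lifts over two boxes that overlap in a slab of width \<open>2 d\<close> glue: correct the second one along a
  cut-off in the \<open>k\<close>-th coordinate, so that the two agree near \<open>x\<^sub>k = c\<close>.\<close>

lemma coset_lift_glue:
  assumes k: "k < n" and d: "0 < d" "a k \<le> c - d" "c + d \<le> b k"
    and g1: "coset_lift p n (open_box n a (b(k := c + d))) g1"
    and g2: "coset_lift p n (open_box n (a(k := c - d)) b) g2"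
  shows "\<exists>g. coset_lift p n (open_box n a b) g"
proof -
  let ?U = "open_box n a (b(k := c + d))" and ?W = "open_box n (a(k := c - d)) b"
  obtain \<rho> where \<rho>: "smooth_real \<rho>" "\<And>t. \<bar>t - c\<bar> \<le> d / 2 \<Longrightarrow> \<rho> t = t" "\<And>t. \<bar>\<rho> t - c\<bar> < d"
    using smooth_cutoff_exists[of "d / 2" d c] d(1) by auto
  define f where "f i = (if i = k then \<rho> else (\<lambda>t. t))" for i
  let ?\<Phi> = "\<lambda>x i. if i < n then f i (x i) else (0::real)"
  have top: "x i = 0" if "x \<in> open_box n a' b'" "i \<ge> n" for x a' b' i
    using that by (auto simp: open_box_def topspace_Euclidean_space)
  have "smooth_between n ?W n (?U \<inter> ?W) ?\<Phi>"
  proof (rule smooth_between_coordinatewise)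
    show "smooth_real (f i)" for i
      using \<rho>(1) smooth_real_affine[of 1 0] by (simp add: f_def)
    show "?\<Phi> x \<in> ?U \<inter> ?W" if x: "x \<in> ?W" for x
    proof -
      have "c - d < \<rho> (x k)" "\<rho> (x k) < c + d" using \<rho>(3)[of "x k"] by linarith+
      then show ?thesis
        using x d k by (auto simp: open_box_def f_def topspace_Euclidean_space split: if_splits)
    qed
  qed (auto intro: openin_open_box)
  then obtain g' where g': "coset_lift p n ?W g'" "\<And>x. x \<in> ?W \<Longrightarrow> ?\<Phi> x = x \<Longrightarrow> g' x = g1 x"
    using coset_lift_twist[OF g1 g2] by blast
  define g where "g = (\<lambda>x\<in>open_box n a b. if x k < c then g1 x else g' x)"
  let ?V1 = "open_box n a (b(k := c))" and ?V2 = "open_box n (a(k := c - d / 2)) b"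
  have V: "?V1 \<subseteq> ?U" "?V2 \<subseteq> ?W" "?V1 \<subseteq> open_box n a b" "?V2 \<subseteq> open_box n a b"
    by (rule open_box_mono; use d in auto)+
  have cover: "\<Union>{?V1, ?V2} = open_box n a b"
  proof
    show "open_box n a b \<subseteq> \<Union>{?V1, ?V2}"
    proof
      fix x assume x: "x \<in> open_box n a b"
      show "x \<in> \<Union>{?V1, ?V2}"
      proof (cases "x k < c")
        case True
        then have "x \<in> ?V1" using x by (auto simp: open_box_def)
        then show ?thesis by simp
      next
        case False
        then have "x \<in> ?V2" using x d(1) by (auto simp: open_box_def)
        then show ?thesis by simp
      qed
    qed
  qed (use V in auto)
  have "restrict g ?V1 = restrict g1 ?V1"
  proof
    fix x
    show "restrict g ?V1 x = restrict g1 ?V1 x"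
    proof (cases "x \<in> ?V1")
      case True
      then have "x \<in> open_box n a b" "x k < c" using V k by (auto simp: open_box_def)
      then show ?thesis by (simp add: g_def)
    qed simp
  qed
  then have 1: "coset_lift p n ?V1 (restrict g ?V1)"
    using coset_lift_restrict[OF g1 openin_open_box V(1)] by simp
  have "restrict g ?V2 = restrict g' ?V2"
  proof
    fix x
    show "restrict g ?V2 x = restrict g' ?V2 x"
    proof (cases "x \<in> ?V2")
      case True
      have "g' x = g1 x" if "x k < c"
      proof (rule g'(2))
        show "x \<in> ?W" using True V(2) by blast
        have "c - d / 2 < x k" using True k by (auto simp: open_box_def)
        then have "\<rho> (x k) = x k" using that d(1) by (intro \<rho>(2)) auto
        then show "?\<Phi> x = x" using top[OF True] by (auto simp: f_def fun_eq_iff)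
      qed
      then show ?thesis using True V(4) by (auto simp: g_def)
    qed simp
  qed
  then have 2: "coset_lift p n ?V2 (restrict g ?V2)"
    using coset_lift_restrict[OF g'(1) openin_open_box V(2)] by simp
  have "coset_lift p n (open_box n a b) g"
    by (rule coset_lift_local[OF _ openin_open_box cover]) (use 1 2 in \<open>auto simp: g_def\<close>)
  then show ?thesis by blast
qed

text \<open>Local lifts are glued in one coordinate after the other. In the first \<open>k\<close> coordinates the box has a
  prescribed bounded size; compactness of \<open>[-N, N]\<close> is what gives a positive width \<open>e\<close> in the others.\<close>

lemma coset_lift_slab:
  assumes local: "\<And>x. x \<in> topspace (Euclidean_space n) \<Longrightarrow>
      \<exists>V g. openin (Euclidean_space n) V \<and> x \<in> V \<and> coset_lift p n V g"
    and N: "0 < N" and "k \<le> n"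
  shows "\<exists>e>0. \<exists>g. coset_lift p n (open_box n (\<lambda>i. if i < k then - N else z i - e)
      (\<lambda>i. if i < k then N else z i + e)) g"
  using \<open>k \<le> n\<close>
proof (induction k arbitrary: z)
  case 0
  define x where "x i = (if i < n then z i else 0)" for i
  have "x \<in> topspace (Euclidean_space n)" by (simp add: x_def topspace_Euclidean_space)
  then obtain V g where V: "openin (Euclidean_space n) V" "x \<in> V" "coset_lift p n V g"
    using local by blast
  obtain e where e: "e > 0" "{y \<in> topspace (Euclidean_space n). \<forall>i<n. \<bar>y i - x i\<bar> < e} \<subseteq> V"
    using openin_Euclidean_space_nhd[OF V(1,2)] by blast
  have "open_box n (\<lambda>i. z i - e) (\<lambda>i. z i + e) \<subseteq> V"
    using e(2) by (fastforce simp: open_box_def x_def abs_less_iff)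
  from coset_lift_restrict[OF V(3) openin_open_box this] show ?case
    using e(1) by auto
next
  case (Suc k)
  then have k: "k < n" by simp
  \<comment> \<open>\<open>P s t\<close>: some lift is defined near the points with \<open>k\<close>-th coordinate in \<open>[s, t]\<close>. The inductive
    hypothesis says that \<open>P\<close> holds for all short intervals, and gluing makes it transitive.\<close>
  define L where "L s e i = (if i < k then - N else if i = k then s - e else z i - e)" for s e i
  define R where "R t e i = (if i < k then N else if i = k then t + e else z i + e)" for t e i
  define P where "P s t \<longleftrightarrow> (\<exists>e>0. \<exists>g. coset_lift p n (open_box n (L s e) (R t e)) g)" for s t
  have "- N \<le> N" using N by simp
  then have "P (- N) N"
  proof (induction rule: Bolzano)
    fix s t u
    assume "P s t" "P t u" "s \<le> t" "t \<le> u"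
    then obtain e1 e2 g1 g2 where e: "e1 > 0" "e2 > 0"
      and g: "coset_lift p n (open_box n (L s e1) (R t e1)) g1"
        "coset_lift p n (open_box n (L t e2) (R u e2)) g2"
      unfolding P_def by blast
    define d where "d = min e1 e2"
    have d: "d > 0" "d \<le> e1" "d \<le> e2" using e by (auto simp: d_def)
    have "open_box n (L s d) ((R u d)(k := t + d)) \<subseteq> open_box n (L s e1) (R t e1)"
      using d by (intro open_box_mono) (auto simp: L_def R_def)
    note g1 = coset_lift_restrict[OF g(1) openin_open_box this]
    have "open_box n ((L s d)(k := t - d)) (R u d) \<subseteq> open_box n (L t e2) (R u e2)"
      using d by (intro open_box_mono) (auto simp: L_def R_def)
    note g2 = coset_lift_restrict[OF g(2) openin_open_box this]
    have "\<exists>g. coset_lift p n (open_box n (L s d) (R u d)) g"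
      by (rule coset_lift_glue[OF k d(1) _ _ g1 g2])
        (use \<open>s \<le> t\<close> \<open>t \<le> u\<close> in \<open>auto simp: L_def R_def\<close>)
    then show "P s u" using d(1) unfolding P_def by blast
  next
    fix x
    assume "- N \<le> x" "x \<le> N"
    obtain e g where e: "e > 0" and g: "coset_lift p n (open_box n
        (\<lambda>i. if i < k then - N else (z(k := x)) i - e) (\<lambda>i. if i < k then N else (z(k := x)) i + e)) g"
      using Suc.IH[of "z(k := x)"] k by auto
    have "P s t" if "s \<le> x" "x \<le> t" "t - s < e / 2" for s t
    proof -
      have "open_box n (L s (e / 2)) (R t (e / 2)) \<subseteq> open_box n
          (\<lambda>i. if i < k then - N else (z(k := x)) i - e) (\<lambda>i. if i < k then N else (z(k := x)) i + e)"
        using that e by (intro open_box_mono) (auto simp: L_def R_def)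
      from coset_lift_restrict[OF g openin_open_box this]
      show ?thesis unfolding P_def using e by (intro exI[of _ "e / 2"]) auto
    qed
    then show "\<exists>d>0. \<forall>s t. s \<le> x \<and> x \<le> t \<and> t - s < d \<longrightarrow> P s t"
      using e by (intro exI[of _ "e / 2"]) auto
  qed
  then obtain e g where e: "e > 0" and g: "coset_lift p n (open_box n (L (- N) e) (R N e)) g"
    unfolding P_def by blast
  have "open_box n (\<lambda>i. if i < Suc k then - N else z i - e) (\<lambda>i. if i < Suc k then N else z i + e)
      \<subseteq> open_box n (L (- N) e) (R N e)"
    using e by (intro open_box_mono) (auto simp: L_def R_def)
  from coset_lift_restrict[OF g openin_open_box this]
  show ?case using e by blast
qed

text \<open>Exhaust \<open>\<real>\<^sup>n\<close> by cubes, correcting the lift over each cube so that it agrees with the lift over the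
  preceding cube on the one before that. At each point the resulting lifts are eventually constant.\<close>

lemma coset_lift_global:
  assumes local: "\<And>x. x \<in> topspace (Euclidean_space n) \<Longrightarrow>
      \<exists>V g. openin (Euclidean_space n) V \<and> x \<in> V \<and> coset_lift p n V g"
  shows "\<exists>g. coset_lift p n (topspace (Euclidean_space n)) g"
proof -
  define C where "C m = open_box n (\<lambda>_. - real m) (\<lambda>_. real m)" for m
  have C_open: "openin (Euclidean_space n) (C m)" for m
    unfolding C_def by (rule openin_open_box)
  have C_mono: "C m \<subseteq> C m'" if "m \<le> m'" for m m'
    unfolding C_def using that by (intro open_box_mono) auto
  have C_iff: "x \<in> C m \<longleftrightarrow> x \<in> topspace (Euclidean_space n) \<and> (\<forall>i<n. \<bar>x i\<bar> < real m)" for x m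
    by (auto simp: C_def open_box_def abs_less_iff)
  have C_lift: "\<exists>g. coset_lift p n (C m) g" if m: "m > 0" for m
  proof -
    obtain e g where e: "e > 0" and g: "coset_lift p n (open_box n
        (\<lambda>i. if i < n then - real m else 0 - e) (\<lambda>i. if i < n then real m else 0 + e)) g"
      using coset_lift_slab[OF local, where k = n and N = "real m" and z = "\<lambda>_. 0"] m by auto
    have "C m \<subseteq> open_box n
        (\<lambda>i. if i < n then - real m else 0 - e) (\<lambda>i. if i < n then real m else 0 + e)"
      unfolding C_def by (intro open_box_mono) auto
    from coset_lift_restrict[OF g C_open this] show ?thesis by blast
  qed
  have extend: "\<exists>g'. coset_lift p n (C (m + 3)) g' \<and> (\<forall>x\<in>C (m + 1). g' x = g x)"
    if g: "coset_lift p n (C (m + 2)) g" for m g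
  proof -
    obtain g2 where g2: "coset_lift p n (C (m + 3)) g2" using C_lift[of "m + 3"] by auto
    obtain \<rho> where \<rho>: "smooth_real \<rho>" "\<And>t. \<bar>t\<bar> \<le> real (m + 1) \<Longrightarrow> \<rho> t = t"
      "\<And>t. \<bar>\<rho> t\<bar> < real (m + 2)"
      using smooth_cutoff_exists[of "real (m + 1)" "real (m + 2)" 0] by auto
    have "smooth_between n (C (m + 3)) n (C (m + 2) \<inter> C (m + 3)) (\<lambda>x i. if i < n then \<rho> (x i) else 0)"
    proof (rule smooth_between_coordinatewise)
      show "(\<lambda>i. if i < n then \<rho> (x i) else 0) \<in> C (m + 2) \<inter> C (m + 3)" for x
      proof -
        have "(\<lambda>i. if i < n then \<rho> (x i) else 0) \<in> C (m + 2)"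
          unfolding C_iff using \<rho>(3) by (auto simp: topspace_Euclidean_space)
        then show ?thesis using C_mono[of "m + 2" "m + 3"] by auto
      qed
    qed (auto intro: C_open \<rho>(1))
    from coset_lift_twist[OF g g2 this] obtain g' where g': "coset_lift p n (C (m + 3)) g'"
      "\<And>x. x \<in> C (m + 3) \<Longrightarrow> (\<lambda>i. if i < n then \<rho> (x i) else 0) = x \<Longrightarrow> g' x = g x"
      by blast
    have "g' x = g x" if x: "x \<in> C (m + 1)" for x
    proof (rule g'(2))
      show "x \<in> C (m + 3)" using x C_mono[of "m + 1" "m + 3"] by auto
      show "(\<lambda>i. if i < n then \<rho> (x i) else 0) = x"
      proof
        fix i show "(if i < n then \<rho> (x i) else 0) = x i"
          using x[unfolded C_iff topspace_Euclidean_space] \<rho>(2)[of "x i"] by (auto simp: less_imp_le)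
      qed
    qed
    then show ?thesis using g'(1) by blast
  qed
  have "\<exists>s. \<forall>m. coset_lift p n (C (m + 2)) (s m) \<and> (\<forall>x\<in>C (m + 1). s (Suc m) x = s m x)"
  proof (rule dependent_nat_choice)
    show "\<exists>g. coset_lift p n (C (0 + 2)) g" by (rule C_lift) simp
    show "\<exists>g'. coset_lift p n (C (Suc m + 2)) g' \<and> (\<forall>x\<in>C (m + 1). g' x = g x)"
      if "coset_lift p n (C (m + 2)) g" for g m
      using extend[OF that] by (simp add: numeral_eq_Suc)
  qed
  then obtain s where s: "\<And>m. coset_lift p n (C (m + 2)) (s m)"
    "\<And>m x. x \<in> C (m + 1) \<Longrightarrow> s (Suc m) x = s m x"
    by blast
  have stable: "s m' x = s m x" if "x \<in> C (m + 1)" "m \<le> m'" for m m' x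
    using that(2)
  proof (induction m' rule: dec_induct)
    case (step i)
    then have "x \<in> C (i + 1)" using that(1) C_mono[of "m + 1" "i + 1"] by auto
    then show ?case using s(2) step by simp
  qed simp
  have exhaust: "\<exists>m. x \<in> C (m + 1)" if x: "x \<in> topspace (Euclidean_space n)" for x
  proof -
    obtain m :: nat where m: "(\<Sum>i<n. \<bar>x i\<bar>) < real m" using reals_Archimedean2 by blast
    have "\<bar>x i\<bar> < real (m + 1)" if "i < n" for i
      using member_le_sum[of i "{..<n}" "\<lambda>i. \<bar>x i\<bar>"] that m by auto
    then show ?thesis using x unfolding C_iff by blast
  qed
  define g where "g = (\<lambda>x\<in>topspace (Euclidean_space n). s (LEAST m. x \<in> C (m + 1)) x)"
  have g: "g x = s m x" if x: "x \<in> C (m + 1)" for m x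
  proof -
    have "x \<in> topspace (Euclidean_space n)" using x by (simp add: C_iff)
    moreover have "s m x = s (LEAST m. x \<in> C (m + 1)) x"
      by (rule stable[OF LeastI[of "\<lambda>m. x \<in> C (m + 1)", OF x] Least_le[of "\<lambda>m. x \<in> C (m + 1)", OF x]])
    ultimately show ?thesis by (simp add: g_def)
  qed
  have "coset_lift p n (topspace (Euclidean_space n)) g"
  proof (rule coset_lift_local)
    show "\<Union>(range (\<lambda>m. C (m + 1))) = topspace (Euclidean_space n)"
      using exhaust by (auto simp: C_iff)
    fix V assume "V \<in> range (\<lambda>m. C (m + 1))"
    then obtain m where V: "V = C (m + 1)" by blast
    have "restrict g V = restrict (s m) V"
      unfolding V using g by (auto simp: restrict_def)
    then show "coset_lift p n V (restrict g V)"
      unfolding V using coset_lift_restrict[OF s(1)[of m] C_open C_mono[of "m + 1" "m + 2"]] by simp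
  qed (auto simp: g_def)
  then show ?thesis by blast
qed

lemma left_coset_plot_lift:
  assumes p: "p \<in> plots (left_coset_space G D H) n (topspace (Euclidean_space n))"
  shows "\<exists>g\<in>plots D n (topspace (Euclidean_space n)). \<forall>x\<in>topspace (Euclidean_space n). p x = g x <# H"
proof -
  let ?R = "{(x, y). x \<in> carrier G \<and> y \<in> carrier G \<and> x <# H = y <# H}"
  have "\<exists>V g. openin (Euclidean_space n) V \<and> x \<in> V \<and> coset_lift p n V g"
    if x: "x \<in> topspace (Euclidean_space n)" for x
  proof -
    from p x obtain V q where V: "openin (Euclidean_space n) V" "x \<in> V" "q \<in> plots D n V"
      "\<forall>v\<in>V. p v = ?R `` {q v}"
      unfolding left_coset_space_def quotient_diffeology_def by force
    have "p v = q v <# H" if "v \<in> V" for v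
      using V(4) that left_coset_class[OF is_group subgroup_H, of "q v"] plot_closed[OF V(3) that]
      by (simp add: points_eq_carrier del: Image_Collect_case_prod Image_singleton)
    then show ?thesis using V unfolding coset_lift_def by blast
  qed
  from coset_lift_global[OF this] show ?thesis unfolding coset_lift_def by blast
qed

end


section \<open>Smooth maps on affine spaces\<close>

lemma points_affine_diffeology:
  "x \<in> points (affine_diffeology n) \<longleftrightarrow> (\<forall>i>n. x i = 0) \<and> (\<Sum>i\<le>n. x i) = 1"
  by (auto simp: affine_diffeology_def sub_diffeology_def topspace_Euclidean_space Suc_le_eq)

lemma plots_affine_diffeology:
  "p \<in> plots (affine_diffeology n) m U \<longleftrightarrow> p \<in> U \<rightarrow>\<^sub>E points (affine_diffeology n) \<and>
    smooth_between m U (Suc n) (topspace (Euclidean_space (Suc n))) p"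
  by (auto simp: affine_diffeology_def sub_diffeology_def euclidean_diffeology_def PiE_def)

lemma affine_plot_closed:
  "p \<in> plots (affine_diffeology n) m U \<Longrightarrow> u \<in> U \<Longrightarrow> p u \<in> points (affine_diffeology n)"
  unfolding plots_affine_diffeology by blast

lemma smooth_maps_plot: "f \<in> smooth_maps X Y \<Longrightarrow> p \<in> plots X n U \<Longrightarrow> compose U f p \<in> plots Y n U"
  unfolding smooth_maps_def by blast

lemma smooth_maps_closed: "f \<in> smooth_maps X Y \<Longrightarrow> x \<in> points X \<Longrightarrow> f x \<in> points Y"
  unfolding smooth_maps_def by blast

lemma affine_push_closed:
  assumes "f \<in> {..m} \<rightarrow> {..n}" "x \<in> points (affine_diffeology m)"
  shows "affine_push m f x \<in> points (affine_diffeology n)"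
proof -
  have "(\<Sum>j\<le>n. affine_push m f x j) = (\<Sum>i\<le>m. x i)"
    using sum.group[of "{..m}" "{..n}" f x] assms(1) by (auto simp: affine_push_def)
  moreover have "affine_push m f x j = 0" if "j > n" for j
  proof -
    have none: "{i. i \<le> m \<and> f i = j} = {}" using funcset_mem[OF assms(1)] that by fastforce
    show ?thesis unfolding affine_push_def none by simp
  qed
  ultimately show ?thesis using assms(2) by (auto simp: points_affine_diffeology)
qed

lemma affine_push_comp:
  assumes "f \<in> {..l} \<rightarrow> {..m}"
  shows "affine_push m g (affine_push l f x) = affine_push l (compose {..l} g f) x"
proof
  fix j
  let ?S = "{h. h \<le> l \<and> g (f h) = j}" and ?T = "{i. i \<le> m \<and> g i = j}"
  have "affine_push m g (affine_push l f x) j = (\<Sum>i\<in>?T. \<Sum>h\<in>{h\<in>?S. f h = i}. x h)"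
    unfolding affine_push_def by (intro sum.cong refl) auto
  also have "\<dots> = (\<Sum>h\<in>?S. x h)"
    using assms by (intro sum.group) auto
  also have "\<dots> = affine_push l (compose {..l} g f) x j"
    unfolding affine_push_def by (intro sum.cong) (auto simp: compose_def)
  finally show "affine_push m g (affine_push l f x) j = affine_push l (compose {..l} g f) x j" .
qed

lemma affine_push_fixed:
  assumes "x \<in> points (affine_diffeology n)" "\<And>i. i \<le> n \<Longrightarrow> f i = i \<or> x i = 0"
  shows "affine_push n f x = x"
proof
  fix j
  have "affine_push n f x j = (\<Sum>i\<in>{i. i \<le> n \<and> f i = j}. if i = j then x j else 0)"
    unfolding affine_push_def by (intro sum.cong) (auto dest: assms(2))
  also have "\<dots> = (if j \<le> n \<and> f j = j then x j else 0)"
    by simp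
  also have "\<dots> = x j"
    using assms by (cases "j \<le> n") (auto simp: points_affine_diffeology)
  finally show "affine_push n f x j = x j" .
qed

lemma affine_push_plot:
  assumes "f \<in> {..m} \<rightarrow> {..n}" and p: "p \<in> plots (affine_diffeology m) l U"
  shows "compose U (affine_push m f) p \<in> plots (affine_diffeology n) l U"
  unfolding plots_affine_diffeology
proof
  have closed: "affine_push m f (p u) \<in> points (affine_diffeology n)" if "u \<in> U" for u
    using affine_push_closed[OF assms(1) affine_plot_closed[OF p that]] .
  then show "compose U (affine_push m f) p \<in> U \<rightarrow>\<^sub>E points (affine_diffeology n)"
    by (auto simp: compose_def)
  have sp: "smooth_between l U (Suc m) (topspace (Euclidean_space (Suc m))) p"
    using p unfolding plots_affine_diffeology by blast
  have "smooth_between l U (Suc n) (topspace (Euclidean_space (Suc n))) (\<lambda>u. affine_push m f (p u))"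
    unfolding smooth_between_def
  proof (intro conjI allI impI)
    show "(\<lambda>u. affine_push m f (p u)) \<in> U \<rightarrow> topspace (Euclidean_space (Suc n))"
      using closed by (auto simp: points_affine_diffeology topspace_Euclidean_space)
    show "Ck_on k l U (\<lambda>u. affine_push m f (p u) j)" for j k
      unfolding affine_push_def by (intro Ck_on_sum smooth_betweenD(4)[OF sp]) auto
  qed (use smooth_betweenD(1)[OF sp] in auto)
  then show "smooth_between l U (Suc n) (topspace (Euclidean_space (Suc n))) (compose U (affine_push m f) p)"
    by (rule smooth_between_cong) (simp add: compose_def)
qed

lemma smooth_maps_affine_push:
  assumes f: "f \<in> {..m} \<rightarrow> {..n}" and \<sigma>: "\<sigma> \<in> smooth_maps (affine_diffeology n) X"
  shows "compose (points (affine_diffeology m)) \<sigma> (affine_push m f) \<in> smooth_maps (affine_diffeology m) X"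
  unfolding smooth_maps_def
proof (intro CollectI conjI allI ballI)
  show "compose (points (affine_diffeology m)) \<sigma> (affine_push m f)
      \<in> points (affine_diffeology m) \<rightarrow>\<^sub>E points X"
    using smooth_maps_closed[OF \<sigma>] affine_push_closed[OF f] by (auto simp: compose_def)
  fix l U p assume p: "p \<in> plots (affine_diffeology m) l U"
  have "compose U (compose (points (affine_diffeology m)) \<sigma> (affine_push m f)) p
      = compose U \<sigma> (compose U (affine_push m f) p)"
    using affine_plot_closed[OF p] by (auto simp: compose_def fun_eq_iff)
  then show "compose U (compose (points (affine_diffeology m)) \<sigma> (affine_push m f)) p \<in> plots X l U"
    using smooth_maps_plot[OF \<sigma> affine_push_plot[OF f p]] by simp
qed

lemma simplicial_set_smooth_singular: "simplicial_set (smooth_singular X)"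
proof
  let ?K = "smooth_singular X"
  have hom: "f \<in> {..m} \<rightarrow> {..n}" if "f \<in> \<Delta>_hom m n" for f m n
    using that unfolding \<Delta>_hom_def by blast
  show "act ?K m n f \<in> simplices ?K n \<rightarrow> simplices ?K m" if "f \<in> \<Delta>_hom m n" for f m n
    using smooth_maps_affine_push[OF hom[OF that]] by (auto simp: smooth_singular_def)
  show "act ?K n n (\<lambda>i\<in>{..n}. i) \<sigma> = \<sigma>" if "\<sigma> \<in> simplices ?K n" for \<sigma> n
  proof
    fix x
    have "affine_push n (\<lambda>i\<in>{..n}. i) x = x" if "x \<in> points (affine_diffeology n)"
      using that by (rule affine_push_fixed) simp
    moreover have "\<sigma> \<in> extensional (points (affine_diffeology n))"
      using that by (auto simp: smooth_singular_def smooth_maps_def PiE_def)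
    ultimately show "act ?K n n (\<lambda>i\<in>{..n}. i) \<sigma> x = \<sigma> x"
      by (auto simp: smooth_singular_def compose_def extensional_def)
  qed
  show "act ?K l n (compose {..l} g f) \<sigma> = act ?K l m f (act ?K m n g \<sigma>)"
    if "f \<in> \<Delta>_hom l m" for f l m g n \<sigma>
    using affine_push_comp[OF hom[OF that]] affine_push_closed[OF hom[OF that]]
    by (simp add: smooth_singular_def compose_def[of "points _"] cong: restrict_cong)
qed

text \<open>For \<open>j \<noteq> k\<close>, the retraction of the affine space onto its face \<open>x\<^sub>j = 0\<close> that adds the \<open>j\<close>-th
  barycentric coordinate to the \<open>k\<close>-th one; for \<open>j = k\<close>, the identity. The underlying map of
  vertices is in general not monotone, so this is no structure map of the singular simplicial set.\<close>

definition collapse :: "nat \<Rightarrow> nat \<Rightarrow> nat \<Rightarrow> (nat \<Rightarrow> real) \<Rightarrow> (nat \<Rightarrow> real)" where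
  "collapse n k j = affine_push n ((\<lambda>i. i)(j := k))"

lemma collapse_closed:
  "k \<le> n \<Longrightarrow> x \<in> points (affine_diffeology n) \<Longrightarrow> collapse n k j x \<in> points (affine_diffeology n)"
  unfolding collapse_def by (rule affine_push_closed) auto

lemma collapse_eq_0: "j \<noteq> k \<Longrightarrow> collapse n k j x j = 0"
proof -
  assume "j \<noteq> k"
  then have none: "{i. i \<le> n \<and> ((\<lambda>i. i)(j := k)) i = j} = {}" by (auto split: if_splits)
  show ?thesis unfolding collapse_def affine_push_def none by simp
qed

lemma collapse_other:
  assumes "x \<in> points (affine_diffeology n)" "i \<noteq> k" "i \<noteq> j"
  shows "collapse n k j x i = x i"
proof -
  have "{l. l \<le> n \<and> ((\<lambda>i. i)(j := k)) l = i} = (if i \<le> n then {i} else {})"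
    using assms(2,3) by (auto split: if_splits)
  then show ?thesis
    using assms(1) by (auto simp: collapse_def affine_push_def points_affine_diffeology)
qed

lemma collapse_fixed:
  "x \<in> points (affine_diffeology n) \<Longrightarrow> x j = 0 \<Longrightarrow> collapse n k j x = x"
  unfolding collapse_def by (rule affine_push_fixed) auto

context diffeological_group
begin

lemma smooth_maps_affine_mult:
  assumes f: "f \<in> smooth_maps (affine_diffeology n) D" and g: "g \<in> smooth_maps (affine_diffeology n) D"
  shows "(\<lambda>x\<in>points (affine_diffeology n). f x \<otimes> g x) \<in> smooth_maps (affine_diffeology n) D"
  unfolding smooth_maps_def
proof (intro CollectI conjI allI ballI)
  show "(\<lambda>x\<in>points (affine_diffeology n). f x \<otimes> g x) \<in> points (affine_diffeology n) \<rightarrow>\<^sub>E points D"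
    using smooth_maps_closed[OF f] smooth_maps_closed[OF g] by (auto simp: points_eq_carrier)
  fix m U p assume p: "p \<in> plots (affine_diffeology n) m U"
  have "(\<lambda>u\<in>U. compose U f p u \<otimes> compose U g p u) \<in> plots D m U"
    by (intro plot_mult smooth_maps_plot[OF f p] smooth_maps_plot[OF g p])
  also have "(\<lambda>u\<in>U. compose U f p u \<otimes> compose U g p u)
      = compose U (\<lambda>x\<in>points (affine_diffeology n). f x \<otimes> g x) p"
    using affine_plot_closed[OF p] by (auto simp: compose_def fun_eq_iff)
  finally show "compose U (\<lambda>x\<in>points (affine_diffeology n). f x \<otimes> g x) p \<in> plots D m U" .
qed

lemma smooth_maps_affine_inv:
  assumes f: "f \<in> smooth_maps (affine_diffeology n) D"
  shows "(\<lambda>x\<in>points (affine_diffeology n). inv (f x)) \<in> smooth_maps (affine_diffeology n) D"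
  unfolding smooth_maps_def
proof (intro CollectI conjI allI ballI)
  show "(\<lambda>x\<in>points (affine_diffeology n). inv (f x)) \<in> points (affine_diffeology n) \<rightarrow>\<^sub>E points D"
    using smooth_maps_closed[OF f] by (auto simp: points_eq_carrier)
  fix m U p assume p: "p \<in> plots (affine_diffeology n) m U"
  have "(\<lambda>u\<in>U. inv (compose U f p u)) \<in> plots D m U"
    by (intro plot_inv smooth_maps_plot[OF f p])
  also have "(\<lambda>u\<in>U. inv (compose U f p u)) = compose U (\<lambda>x\<in>points (affine_diffeology n). inv (f x)) p"
    using affine_plot_closed[OF p] by (auto simp: compose_def fun_eq_iff)
  finally show "compose U (\<lambda>x\<in>points (affine_diffeology n). inv (f x)) p \<in> plots D m U" .
qed

lemma smooth_maps_affine_one: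
  "(\<lambda>x\<in>points (affine_diffeology n). \<one>) \<in> smooth_maps (affine_diffeology n) D"
  unfolding smooth_maps_def
proof (intro CollectI conjI allI ballI)
  show "(\<lambda>x\<in>points (affine_diffeology n). \<one>) \<in> points (affine_diffeology n) \<rightarrow>\<^sub>E points D"
    by (auto simp: points_eq_carrier)
  fix m U p assume p: "p \<in> plots (affine_diffeology n) m U"
  then have "openin (Euclidean_space m) U"
    unfolding plots_affine_diffeology by (blast dest: smooth_betweenD(1))
  then have "(\<lambda>u\<in>U. \<one>) \<in> plots D m U"
    by (rule plot_const) (simp add: points_eq_carrier)
  also have "(\<lambda>u\<in>U. \<one>) = compose U (\<lambda>x\<in>points (affine_diffeology n). \<one>) p"
    using affine_plot_closed[OF p] by (auto simp: compose_def fun_eq_iff)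
  finally show "compose U (\<lambda>x\<in>points (affine_diffeology n). \<one>) p \<in> plots D m U" .
qed

end

context homogeneous_space
begin

lemma left_coset_plot:
  assumes q: "q \<in> plots D n U"
  shows "(\<lambda>u\<in>U. q u <# H) \<in> plots (left_coset_space G D H) n U"
proof -
  let ?R = "{(x, y). x \<in> carrier G \<and> y \<in> carrier G \<and> x <# H = y <# H}"
  have qc: "q u \<in> carrier G" if "u \<in> U" for u
    using plot_closed[OF q that] by (simp add: points_eq_carrier)
  have cl: "q u <# H = ?R `` {q u}" if "u \<in> U" for u
    using left_coset_class[OF is_group subgroup_H qc[OF that]] by simp
  have "(\<lambda>u\<in>U. q u <# H) \<in> U \<rightarrow>\<^sub>E points (left_coset_space G D H)"
    using qc points_left_coset_space[OF diffeological_group_axioms subgroup_H] by auto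
  then have fn: "(\<lambda>u\<in>U. q u <# H) \<in> U \<rightarrow>\<^sub>E points D // ?R"
    by (simp add: left_coset_space_def quotient_diffeology_def)
  have "\<exists>V q'. openin (Euclidean_space n) V \<and> u \<in> V \<and> V \<subseteq> U \<and> q' \<in> plots D n V \<and>
      (\<forall>v\<in>V. (\<lambda>u\<in>U. q u <# H) v = ?R `` {q' v})" if "u \<in> U" for u
    by (intro exI[of _ U] exI[of _ q] conjI ballI)
      (use that q plot_domain[OF q] cl in \<open>simp_all del: Image_Collect_case_prod Image_singleton\<close>)
  then show ?thesis
    using fn plot_domain[OF q] unfolding left_coset_space_def quotient_diffeology_def
    by (simp del: Image_Collect_case_prod Image_singleton)
qed

lemma smooth_maps_affine_left_coset:
  assumes g: "g \<in> smooth_maps (affine_diffeology n) D"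
  shows "(\<lambda>x\<in>points (affine_diffeology n). g x <# H)
    \<in> smooth_maps (affine_diffeology n) (left_coset_space G D H)"
  unfolding smooth_maps_def
proof (intro CollectI conjI allI ballI)
  show "(\<lambda>x\<in>points (affine_diffeology n). g x <# H)
      \<in> points (affine_diffeology n) \<rightarrow>\<^sub>E points (left_coset_space G D H)"
    using smooth_maps_closed[OF g] points_left_coset_space[OF diffeological_group_axioms subgroup_H]
    by (auto simp: points_eq_carrier)
  fix m U p assume p: "p \<in> plots (affine_diffeology n) m U"
  have "(\<lambda>u\<in>U. compose U g p u <# H) \<in> plots (left_coset_space G D H) m U"
    by (rule left_coset_plot[OF smooth_maps_plot[OF g p]])
  also have "(\<lambda>u\<in>U. compose U g p u <# H) = compose U (\<lambda>x\<in>points (affine_diffeology n). g x <# H) p"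
    using affine_plot_closed[OF p] by (auto simp: compose_def fun_eq_iff)
  finally show "compose U (\<lambda>x\<in>points (affine_diffeology n). g x <# H) p
      \<in> plots (left_coset_space G D H) m U" .
qed

text \<open>The affine space of dimension \<open>n\<close> is identified with \<open>\<real>\<^sup>n\<close> by omitting its last coordinate.\<close>

lemma left_coset_smooth_map_lift:
  assumes \<sigma>: "\<sigma> \<in> smooth_maps (affine_diffeology n) (left_coset_space G D H)"
  shows "\<exists>g\<in>smooth_maps (affine_diffeology n) D. \<forall>x\<in>points (affine_diffeology n). \<sigma> x = g x <# H"
proof -
  let ?A = "points (affine_diffeology n)" and ?R = "topspace (Euclidean_space n)"
  define c where "c y i = (if i < n then y i else if i = n then 1 + (\<Sum>l<n. - y l) else 0)"
    for y :: "nat \<Rightarrow> real" and i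
  have open_R: "openin (Euclidean_space n) ?R" by simp
  have cA: "c y \<in> ?A" for y
    by (auto simp: points_affine_diffeology c_def sum_negf simp flip: lessThan_Suc_atMost)
  have "smooth_between n ?R (Suc n) (topspace (Euclidean_space (Suc n))) c"
    unfolding smooth_between_def
  proof (intro conjI allI impI)
    show "Ck_on k n ?R (\<lambda>y. c y j)" for j k
    proof -
      have "Ck_on k n ?R (\<lambda>y. - y l)" for l
        using Ck_on_smooth_real[OF smooth_real_affine[of "- 1" 0]] by simp
      then have "Ck_on k n ?R (\<lambda>y. 1 + (\<Sum>l<n. - y l))"
        by (intro Ck_on_add Ck_on_const Ck_on_sum)
      then show ?thesis
        by (cases "j < n"; cases "j = n") (auto simp: c_def intro: Ck_on_coordinate Ck_on_const)
    qed
    show "c \<in> ?R \<rightarrow> topspace (Euclidean_space (Suc n))"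
      by (auto simp: c_def topspace_Euclidean_space)
  qed simp_all
  then have "smooth_between n ?R (Suc n) (topspace (Euclidean_space (Suc n))) (restrict c ?R)"
    by (rule smooth_between_cong) simp
  then have "restrict c ?R \<in> plots (affine_diffeology n) n ?R"
    using cA by (auto simp: plots_affine_diffeology)
  then obtain g0 where g0: "g0 \<in> plots D n ?R"
    "\<And>y. y \<in> ?R \<Longrightarrow> compose ?R \<sigma> (restrict c ?R) y = g0 y <# H"
    using left_coset_plot_lift[OF smooth_maps_plot[OF \<sigma>]] by blast
  define r where "r x i = (if i < n then x i else 0)" for x :: "nat \<Rightarrow> real" and i
  have rR: "r x \<in> ?R" for x by (simp add: r_def topspace_Euclidean_space)
  define g where "g = (\<lambda>x\<in>?A. g0 (r x))"
  have "c (r x) = x" if x: "x \<in> ?A" for x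
    using x by (auto simp: fun_eq_iff c_def r_def sum_negf points_affine_diffeology
        simp flip: lessThan_Suc_atMost)
  then have "\<sigma> x = g x <# H" if "x \<in> ?A" for x
    using g0(2)[OF rR[of x]] that rR[of x] by (simp add: g_def compose_def)
  moreover have "g \<in> smooth_maps (affine_diffeology n) D"
    unfolding smooth_maps_def
  proof (intro CollectI conjI allI ballI)
    show "g \<in> ?A \<rightarrow>\<^sub>E points D"
      using plot_closed[OF g0(1) rR] by (auto simp: g_def)
    fix m U p assume p: "p \<in> plots (affine_diffeology n) m U"
    then have sp: "smooth_between m U (Suc n) (topspace (Euclidean_space (Suc n))) p"
      unfolding plots_affine_diffeology by blast
    have "smooth_between m U n ?R (\<lambda>u. r (p u))"
      unfolding smooth_between_def
    proof (intro conjI allI impI)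
      show "Ck_on k m U (\<lambda>u. r (p u) j)" if "j < n" for j k
        using that smooth_betweenD(4)[OF sp, of j k] by (simp add: r_def)
    qed (use rR smooth_betweenD(1)[OF sp] in auto)
    then have "compose U g0 (\<lambda>u. r (p u)) \<in> plots D m U"
      by (rule plot_compose[OF g0(1)])
    also have "compose U g0 (\<lambda>u. r (p u)) = compose U g p"
      using affine_plot_closed[OF p] by (auto simp: compose_def g_def fun_eq_iff)
    finally show "compose U g p \<in> plots D m U" .
  qed
  ultimately show ?thesis by blast
qed


section \<open>Filling horns\<close>

text \<open>Given smooth coset-valued maps \<open>\<tau> i\<close> that agree on the intersections of the faces \<open>x\<^sub>i = 0\<close>,
  some smooth \<open>F\<close> to the group induces \<open>\<tau> i\<close> on each face \<open>x\<^sub>i = 0\<close>, for \<open>i \<in> J\<close>. The faces are treated one by one: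
  if \<open>F\<close> is right on the faces in \<open>I\<close>, if \<open>t\<close> lifts \<open>\<tau> j\<close> and \<open>P\<close> is the retraction onto the face
  \<open>j\<close>, then \<open>x \<mapsto> F x (F (P x))\<^sup>-\<^sup>1 t (P x)\<close> is \<open>t\<close> on the face \<open>j\<close>, and on the faces in \<open>I\<close> it differs
  from \<open>F\<close> by a factor in \<open>H\<close>.\<close>

lemma fill_faces:
  assumes k: "k \<le> n"
    and smooth: "\<And>i. i \<in> J \<Longrightarrow> \<tau> i \<in> smooth_maps (affine_diffeology n) (left_coset_space G D H)"
    and compat: "\<And>i j x. i \<in> J \<Longrightarrow> j \<in> J \<Longrightarrow> x \<in> points (affine_diffeology n) \<Longrightarrow>
      x i = 0 \<Longrightarrow> x j = 0 \<Longrightarrow> \<tau> i x = \<tau> j x"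
    and J: "finite J" "k \<notin> J"
  shows "\<exists>F\<in>smooth_maps (affine_diffeology n) D.
    \<forall>i\<in>J. \<forall>x\<in>points (affine_diffeology n). x i = 0 \<longrightarrow> \<tau> i x = F x <# H"
  using J smooth compat
proof (induction J rule: finite_induct)
  case empty
  show ?case using smooth_maps_affine_one by blast
next
  case (insert j I)
  let ?A = "points (affine_diffeology n)"
  have "\<exists>F\<in>smooth_maps (affine_diffeology n) D. \<forall>i\<in>I. \<forall>x\<in>?A. x i = 0 \<longrightarrow> \<tau> i x = F x <# H"
    by (rule insert.IH) (use insert.prems in \<open>simp, blast+\<close>)
  then obtain F where F: "F \<in> smooth_maps (affine_diffeology n) D"
    "\<And>i x. i \<in> I \<Longrightarrow> x \<in> ?A \<Longrightarrow> x i = 0 \<Longrightarrow> \<tau> i x = F x <# H"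
    by blast
  obtain t where t: "t \<in> smooth_maps (affine_diffeology n) D" "\<And>x. x \<in> ?A \<Longrightarrow> \<tau> j x = t x <# H"
    using left_coset_smooth_map_lift[OF insert.prems(2)[of j]] by blast
  have jk: "j \<noteq> k" using insert.prems(1) by auto
  let ?P = "collapse n k j"
  have P: "compose ?A f ?P \<in> smooth_maps (affine_diffeology n) D"
    if "f \<in> smooth_maps (affine_diffeology n) D" for f
    unfolding collapse_def by (rule smooth_maps_affine_push[OF _ that]) (use k in auto)
  have PA: "?P x \<in> ?A" if "x \<in> ?A" for x
    using k that by (rule collapse_closed)
  define F' where "F' = (\<lambda>x\<in>?A. F x \<otimes> inv (F (?P x)) \<otimes> t (?P x))"
  have "(\<lambda>x\<in>?A. (\<lambda>x\<in>?A. F x \<otimes> (\<lambda>x\<in>?A. inv (compose ?A F ?P x)) x) x \<otimes> compose ?A t ?P x)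
      \<in> smooth_maps (affine_diffeology n) D"
    by (intro smooth_maps_affine_mult smooth_maps_affine_inv P F(1) t(1))
  also have "(\<lambda>x\<in>?A. (\<lambda>x\<in>?A. F x \<otimes> (\<lambda>x\<in>?A. inv (compose ?A F ?P x)) x) x \<otimes> compose ?A t ?P x) = F'"
    by (auto simp: F'_def compose_def fun_eq_iff)
  finally have F': "F' \<in> smooth_maps (affine_diffeology n) D" .
  have c: "F x \<in> carrier G" "t x \<in> carrier G" if "x \<in> ?A" for x
    using smooth_maps_closed[OF F(1) that] smooth_maps_closed[OF t(1) that] by (simp_all add: points_eq_carrier)
  have "\<tau> i x = F' x <# H" if i: "i \<in> insert j I" and x: "x \<in> ?A" "x i = 0" for i x
  proof (cases "i = j")
    case True
    then have "?P x = x" using x by (intro collapse_fixed) auto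
    then have "F' x = t x" using c[OF x(1)] x(1) by (simp add: F'_def)
    then show ?thesis using t(2)[OF x(1)] True by simp
  next
    case False
    then have iI: "i \<in> I" "i \<noteq> k" using i insert.prems(1) by auto
    have 0: "?P x i = 0" "?P x j = 0"
      using collapse_other[OF x(1) iI(2) False] x(2) collapse_eq_0[OF jk] by auto
    have "F (?P x) <# H = \<tau> i (?P x)" using F(2)[OF iI(1) PA[OF x(1)] 0(1)] by simp
    also have "\<dots> = \<tau> j (?P x)"
      using insert.prems(3)[of i j "?P x"] iI(1) PA[OF x(1)] 0 by auto
    also have "\<dots> = t (?P x) <# H" using t(2)[OF PA[OF x(1)]] .
    finally have "F' x <# H = F x <# H"
      using coset_twist c[OF x(1)] c[OF PA[OF x(1)]] x(1) by (simp add: F'_def)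
    then show ?thesis using F(2)[OF iI(1) x] by simp
  qed
  then show ?case using F' by blast
qed

end

text \<open>A monotone retraction of the natural numbers onto a finite nonempty set \<open>S\<close>.\<close>

definition monotone_retract :: "nat set \<Rightarrow> nat \<Rightarrow> nat" where
  "monotone_retract S j = (if \<exists>s\<in>S. s \<le> j then Max {s \<in> S. s \<le> j} else Min S)"

lemma monotone_retract_in:
  assumes "finite S" "S \<noteq> {}"
  shows "monotone_retract S j \<in> S"
proof (cases "\<exists>s\<in>S. s \<le> j")
  case True
  then have "Max {s \<in> S. s \<le> j} \<in> {s \<in> S. s \<le> j}" using assms(1) by (intro Max_in) auto
  then show ?thesis using True by (simp add: monotone_retract_def)
next
  case False
  then show ?thesis using assms by (simp add: monotone_retract_def)
qed

lemma monotone_retract_fixed: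
  assumes "finite S" "j \<in> S"
  shows "monotone_retract S j = j"
proof -
  have "Max {s \<in> S. s \<le> j} = j" using assms by (intro Max_eqI) auto
  then show ?thesis using assms by (auto simp: monotone_retract_def)
qed

lemma mono_monotone_retract:
  assumes "finite S" "S \<noteq> {}"
  shows "mono (monotone_retract S)"
proof (rule monoI)
  fix i j :: nat assume ij: "i \<le> j"
  consider "\<exists>s\<in>S. s \<le> i" | "\<not> (\<exists>s\<in>S. s \<le> i)" by blast
  then show "monotone_retract S i \<le> monotone_retract S j"
  proof cases
    case 1
    then have "Max {s \<in> S. s \<le> i} \<le> Max {s \<in> S. s \<le> j}"
      using ij assms(1) by (intro Max_mono) auto
    moreover have "\<exists>s\<in>S. s \<le> j" using 1 ij le_trans by blast
    ultimately show ?thesis using 1 by (simp add: monotone_retract_def)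
  next
    case 2
    then have "monotone_retract S i = Min S" by (simp add: monotone_retract_def)
    then show ?thesis using assms monotone_retract_in[OF assms, of j] by simp
  qed
qed

lemma monotone_retract_\<Delta>_hom:
  assumes "S \<subseteq> {..n}" "S \<noteq> {}"
  shows "restrict (monotone_retract S) {..n} \<in> \<Delta>_hom n n"
proof -
  have "finite S" using assms(1) finite_subset by blast
  then show ?thesis
    using monotone_retract_in[OF _ assms(2)] mono_monotone_retract[OF _ assms(2)] assms(1)
    by (auto simp: \<Delta>_hom_def mono_on_def mono_def subset_iff)
qed

lemma (in homogeneous_space) kan_complex_left_coset_space:
  "kan_complex (smooth_singular (left_coset_space G D H))"
  unfolding kan_complex_def
proof (intro conjI allI impI)
  let ?K = "smooth_singular (left_coset_space G D H)"
  interpret K: simplicial_set ?K by (rule simplicial_set_smooth_singular)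
  show "simplicial_set ?K" by (rule simplicial_set_smooth_singular)
  fix n k \<phi>
  assume n: "n \<ge> 1" and k: "k \<le> n" and \<phi>: "simplicial_map (horn n k) ?K \<phi>"
  let ?A = "\<lambda>n. points (affine_diffeology n)"
  define e where "e S = restrict (monotone_retract S) {..n}" for S
  have e_horn: "e S \<in> simplices (horn n k) n" if "S \<subseteq> {..n}" "S \<noteq> {}" "i \<le> n" "i \<noteq> k" "i \<notin> S" for S i
  proof -
    have "finite S" using that(1) finite_subset by blast
    then have "i \<notin> e S ` {..n}"
      using monotone_retract_in[OF _ that(2)] that(5) by (auto simp: e_def)
    then show ?thesis
      using monotone_retract_\<Delta>_hom[OF that(1,2)] that(3,4) by (auto simp: horn_def e_def)
  qed
  define \<tau> where "\<tau> i = \<phi> n (e ({..n} - {i}))" for i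
  have face_nonempty: "{..n} - {i} \<noteq> {}" for i
    using n by (cases "i = 0") (auto simp: set_eq_iff intro: exI[of _ 1])
  have face_horn: "e ({..n} - {i}) \<in> simplices (horn n k) n" if "i \<le> n" "i \<noteq> k" for i
    using e_horn[OF _ face_nonempty that] by blast
  \<comment> \<open>\<open>\<tau> i\<close> is the value of \<open>\<phi>\<close> on the idempotent onto the vertices other than \<open>i\<close>; every simplex
    \<open>f\<close> missing \<open>i\<close> is unchanged by composing it with that idempotent.\<close>
  have restrict_face: "\<phi> m f = act ?K m n f (\<tau> i)"
    if f: "f \<in> \<Delta>_hom m n" and i: "i \<le> n" "i \<noteq> k" "i \<notin> f ` {..m}" for m f i
  proof -
    have "act (horn n k) m n f (e ({..n} - {i})) = f"
    proof
      fix l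
      show "act (horn n k) m n f (e ({..n} - {i})) l = f l"
      proof (cases "l \<le> m")
        case True
        then have "f l \<in> {..n} - {i}" using f i(3) by (auto simp: \<Delta>_hom_def)
        then show ?thesis
          using True monotone_retract_fixed[of "{..n} - {i}"]
          by (auto simp: horn_def compose_def e_def)
      next
        case False
        then show ?thesis using f by (auto simp: horn_def compose_def \<Delta>_hom_def PiE_def extensional_def)
      qed
    qed
    then show ?thesis
      using \<phi> f face_horn[OF i(1,2)] unfolding simplicial_map_def \<tau>_def by metis
  qed
  have act_apply: "act ?K m n f \<sigma> x = \<sigma> (affine_push m f x)" if "x \<in> ?A m" for m f \<sigma> x
    using that by (simp add: smooth_singular_def compose_def)
  have \<tau>_smooth: "\<tau> i \<in> smooth_maps (affine_diffeology n) (left_coset_space G D H)"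
    if "i \<in> {..n} - {k}" for i
    using \<phi> face_horn[of i] that unfolding simplicial_map_def \<tau>_def by (auto simp: smooth_singular_def)
  have compat: "\<tau> i x = \<tau> j x"
    if ij: "i \<in> {..n} - {k}" "j \<in> {..n} - {k}" and x: "x \<in> ?A n" "x i = 0" "x j = 0" for i j x
  proof -
    \<comment> \<open>Both sides are the value of \<open>\<phi>\<close> on the idempotent onto the vertices other than \<open>i\<close> and \<open>j\<close>;
      there are such vertices, as \<open>k\<close> is one.\<close>
    let ?S = "{..n} - {i, j}"
    have S: "?S \<noteq> {}" "?S \<subseteq> {..n}" using ij k by auto
    have fixed: "affine_push n (e ?S) x = x"
      using x(1) by (rule affine_push_fixed) (use x monotone_retract_fixed[of ?S] in \<open>auto simp: e_def\<close>)
    have "\<phi> n (e ?S) x = \<tau> l x" if l: "l = i \<or> l = j" for l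
    proof -
      have "l \<notin> e ?S ` {..n}" using monotone_retract_in[of ?S] S(1) l by (auto simp: e_def)
      moreover have "e ?S \<in> \<Delta>_hom n n" using monotone_retract_\<Delta>_hom[OF S(2,1)] by (simp add: e_def)
      ultimately have "\<phi> n (e ?S) = act ?K n n (e ?S) (\<tau> l)"
        using restrict_face l ij by blast
      then show ?thesis using act_apply[OF x(1)] fixed by simp
    qed
    then show ?thesis by metis
  qed
  have "\<exists>F\<in>smooth_maps (affine_diffeology n) D.
      \<forall>i\<in>{..n} - {k}. \<forall>x\<in>?A n. x i = 0 \<longrightarrow> \<tau> i x = F x <# H"
  proof (rule fill_faces[OF k])
    show "\<tau> i \<in> smooth_maps (affine_diffeology n) (left_coset_space G D H)" if "i \<in> {..n} - {k}" for i
      using that by (rule \<tau>_smooth)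
    show "\<tau> i x = \<tau> j x" if "i \<in> {..n} - {k}" "j \<in> {..n} - {k}" "x \<in> ?A n" "x i = 0" "x j = 0" for i j x
      using that by (rule compat)
  qed auto
  then obtain F where F: "F \<in> smooth_maps (affine_diffeology n) D"
    "\<And>i x. i \<in> {..n} - {k} \<Longrightarrow> x \<in> ?A n \<Longrightarrow> x i = 0 \<Longrightarrow> \<tau> i x = F x <# H"
    by blast
  define \<Sigma> where "\<Sigma> = (\<lambda>x\<in>?A n. F x <# H)"
  have \<Sigma>: "\<Sigma> \<in> simplices ?K n"
    using smooth_maps_affine_left_coset[OF F(1)] by (simp add: \<Sigma>_def smooth_singular_def)
  define \<psi> where "\<psi> m f = act ?K m n f \<Sigma>" for m f
  have "simplicial_map (std_simplex n) ?K \<psi>"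
    unfolding simplicial_map_def
  proof (intro conjI allI ballI)
    show "\<psi> m \<in> simplices (std_simplex n) m \<rightarrow> simplices ?K m" for m
      using funcset_mem[OF K.act_closed \<Sigma>] by (auto simp: \<psi>_def std_simplex_def)
    show "\<psi> l (act (std_simplex n) l m f g) = act ?K l m f (\<psi> m g)"
      if "f \<in> \<Delta>_hom l m" "g \<in> simplices (std_simplex n) m" for l m f g
      using that K.act_compose[OF that(1) _ \<Sigma>] by (simp add: \<psi>_def std_simplex_def)
  qed
  moreover have "\<psi> m f = \<phi> m f" if f: "f \<in> simplices (horn n k) m" for m f
  proof -
    obtain i where i: "i \<le> n" "i \<noteq> k" "i \<notin> f ` {..m}" and fh: "f \<in> \<Delta>_hom m n"
      using f by (auto simp: horn_def)
    have fm: "f \<in> {..m} \<rightarrow> {..n}" using fh by (auto simp: \<Delta>_hom_def)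
    have "\<psi> m f x = act ?K m n f (\<tau> i) x" for x
    proof (cases "x \<in> ?A m")
      case True
      have y: "affine_push m f x \<in> ?A n" using affine_push_closed[OF fm True] .
      have none: "{l. l \<le> m \<and> f l = i} = {}" using i(3) by auto
      have "affine_push m f x i = 0" unfolding affine_push_def none by simp
      then have "\<tau> i (affine_push m f x) = \<Sigma> (affine_push m f x)"
        using F(2)[of i] i y by (simp add: \<Sigma>_def)
      then show ?thesis using act_apply[OF True] by (simp add: \<psi>_def)
    next
      case False
      then show ?thesis by (simp add: \<psi>_def smooth_singular_def compose_def)
    qed
    then show ?thesis using restrict_face[OF fh i] by auto
  qed
  ultimately show "\<exists>\<psi>. simplicial_map (std_simplex n) ?K \<psi> \<and>
      (\<forall>m. \<forall>x\<in>simplices (horn n k) m. \<psi> m x = \<phi> m x)"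
    by blast
qed


section \<open>Left and right coset spaces\<close>

lemma fibrant_left_coset_space:
  assumes "diffeological_group G D" "subgroup H G"
  shows "fibrant (left_coset_space G D H)"
proof -
  interpret homogeneous_space G D H
    using assms by (simp add: homogeneous_space_def homogeneous_space_axioms_def)
  have "diffeological_space (left_coset_space G D H)"
    unfolding left_coset_space_def by (rule diffeological_space_quotient) unfold_locales
  then show ?thesis
    unfolding fibrant_def using kan_complex_left_coset_space by blast
qed

text \<open>The opposite group, whose left cosets are the right cosets of the original one.\<close>

definition opposite :: "('a, 'b) monoid_scheme \<Rightarrow> ('a, 'b) monoid_scheme" where
  "opposite G = G\<lparr>mult := \<lambda>x y. y \<otimes>\<^bsub>G\<^esub> x\<rparr>"

lemma opposite_simps [simp]:
  "carrier (opposite G) = carrier G" "one (opposite G) = one G"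
  "mult (opposite G) x y = mult G y x"
  by (simp_all add: opposite_def)

lemma group_opposite:
  assumes "group G"
  shows "group (opposite G)"
proof -
  interpret group G by fact
  show ?thesis
    by (rule groupI) (auto simp: m_assoc intro: r_inv_ex)
qed

lemma inv_opposite:
  assumes "group G" "x \<in> carrier G"
  shows "inv\<^bsub>opposite G\<^esub> x = inv\<^bsub>G\<^esub> x"
proof -
  interpret group G by fact
  show ?thesis
    using assms(2) by (intro group.inv_equality[OF group_opposite[OF assms(1)]]) auto
qed

lemma subgroup_opposite:
  assumes "group G" "subgroup H G"
  shows "subgroup H (opposite G)"
proof
  interpret subgroup H G by fact
  show "H \<subseteq> carrier (opposite G)" by auto
  show "x \<otimes>\<^bsub>opposite G\<^esub> y \<in> H" if "x \<in> H" "y \<in> H" for x y using that by simp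
  show "\<one>\<^bsub>opposite G\<^esub> \<in> H" by simp
  show "inv\<^bsub>opposite G\<^esub> x \<in> H" if "x \<in> H" for x
    using that inv_opposite[OF assms(1)] m_inv_closed by auto
qed

lemma diffeological_group_opposite:
  assumes "diffeological_group G D"
  shows "diffeological_group (opposite G) D"
proof -
  interpret diffeological_group G D by fact
  interpret op: group "opposite G" by (rule group_opposite) (rule is_group)
  show ?thesis
  proof
    show "points D = carrier (opposite G)" by (simp add: points_eq_carrier)
    show "(\<lambda>x \<in> carrier (opposite G). inv\<^bsub>opposite G\<^esub> x) \<in> smooth_maps D D"
      using smooth_inv by (simp add: inv_opposite[OF is_group] cong: restrict_cong)
    let ?m = "\<lambda>z \<in> carrier G \<times> carrier G. snd z \<otimes>\<^bsub>G\<^esub> fst z"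
    have "?m \<in> smooth_maps (product_diffeology D D) D"
      unfolding smooth_maps_def
    proof (intro CollectI conjI allI ballI)
      show "?m \<in> points (product_diffeology D D) \<rightarrow>\<^sub>E points D"
        by (auto simp: product_diffeology_def points_eq_carrier)
      fix n U p assume "p \<in> plots (product_diffeology D D) n U"
      then have p: "p \<in> U \<rightarrow>\<^sub>E carrier G \<times> carrier G"
        "compose U fst p \<in> plots D n U" "compose U snd p \<in> plots D n U"
        by (auto simp: product_diffeology_def points_eq_carrier)
      have "(\<lambda>u\<in>U. compose U snd p u \<otimes>\<^bsub>G\<^esub> compose U fst p u) \<in> plots D n U"
        by (rule plot_mult[OF p(3,2)])
      also have "(\<lambda>u\<in>U. compose U snd p u \<otimes>\<^bsub>G\<^esub> compose U fst p u) = compose U ?m p"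
      proof
        fix u
        show "(\<lambda>u\<in>U. compose U snd p u \<otimes>\<^bsub>G\<^esub> compose U fst p u) u = compose U ?m p u"
        proof (cases "u \<in> U")
          case True
          then have "p u \<in> carrier G \<times> carrier G" using p(1) by blast
          then show ?thesis using True by (simp add: compose_def)
        qed (simp add: compose_def)
      qed
      finally show "compose U ?m p \<in> plots D n U" .
    qed
    then show "(\<lambda>z \<in> carrier (opposite G) \<times> carrier (opposite G). fst z \<otimes>\<^bsub>opposite G\<^esub> snd z)
        \<in> smooth_maps (product_diffeology D D) D"
      by simp
  qed
qed

lemma right_coset_space_eq_opposite:
  "right_coset_space G D H = left_coset_space (opposite G) D H"
  by (simp add: right_coset_space_def left_coset_space_def r_coset_def l_coset_def)

theorem theorem4p34:
  fixes G :: "('a, 'b) monoid_scheme" and D :: "'a diffeology" and H :: "'a set"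
  assumes "diffeological_group G D" and "subgroup H G"
  shows "fibrant (left_coset_space G D H) \<and> fibrant (right_coset_space G D H)"
proof
  show "fibrant (left_coset_space G D H)"
    using assms by (rule fibrant_left_coset_space)
  have "group G"
    using assms(1) by (simp add: diffeological_group_def)
  then show "fibrant (right_coset_space G D H)"
    unfolding right_coset_space_eq_opposite
    by (intro fibrant_left_coset_space diffeological_group_opposite subgroup_opposite assms)
qed

end
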